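(* Let $h$ be a Hardy field function with growth rate $c$, where $1<c<\frac{6}{5}$, and let \[ S_h = \{ \pm \lfloor h(n) \rfloor : n \in \mathbb{N} \}. \] Then for every $\varepsilon>0$ and all $N\in\mathbb{N}$, \[ \gamma_{S_h}(N) \ll_{h,\varepsilon} N^{-\left(\frac{6}{5c}-1\right)+\varepsilon}. \] Thus if $A \subseteq \{1,\dotsc,N\}$ lacks configurations of the form $\{x, x \pm \lfloor h(n) \rfloor \}$ with $h(n) \neq 0$ (that is, there are no integer $x$, $n\in\mathbb{N}$ with $h(n)\ne 0$, and choice of sign $\pm$ such that both $x$ and $x\pm\lfloor h(n)\rfloor$ lie in $A$), then for every $\varepsilon>0$ \[ |A| \ll_{h,\varepsilon} N^{1-\left(\frac{6}{5c}-1\right)+\varepsilon}. \]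
   Context: $\mathbb{N}=\{1,2,3,\dotsc\}$; $\lfloor\cdot\rfloor$ is the floor function; $|A|$ is the cardinality of $A$. The notation $X\ll_p Y$ means $|X|\le C\,Y$ for a constant $C>0$ depending only on the parameters $p$ (here, independent of $N$ and $A$). Hardy fields. Consider smooth functions $h:(u,\infty)\to\mathbb{R}$ with $u\in\mathbb{R}\cup\{-\infty\}$. Two such functions are equivalent if they agree for all sufficiently large $t$; equivalence classes are called germs at infinity, and they form a ring under pointwise addition and multiplication. A Hardy field is a subfield of the ring of germs at infinity which is closed under differentiation. A Hardy field function is a smooth function $h:(u,\infty)\to\mathbb{R}$, with $u\in\mathbb{R}\cup\{-\infty\}$, whose germ at infinity belongs to some Hardy field. The growth rate of $h$ is \[ \inf\{\alpha\in\mathbb{R} : |h(t)|\le t^\alpha \text{ for all sufficiently large } t\}. \] Whenever $h(n)$ is written, $n$ is restricted to those positive integers lying in the domain of $h$. For a set $S$ of integers, let $\mathcal{T}_{S\cap\{1,\dotsc,N\}}$ denote the set of real trigonometric polynomials \[ T(\xi)=a_0+\sum_{s\in S\cap\{1,\dotsc,N\}} a_s\cos(2\pi s\xi)\qquad (a_0,a_s\in\mathbb{R}) \] satisfying $T(\xi)\ge 0$ for all $\xi\in\mathbb{R}$ and $T(0)=1$. Define \[ \gamma_S(N)=\inf_{T\in\mathcal{T}_{S\cap\{1,\dotsc,N\}}} a_0, \] where $a_0$ denotes the constant coefficient of $T$. *)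

theory Defs
  imports "HOL-Analysis.Analysis" "HOL-Algebra.Subrings"
begin

section \<open>Smooth functions on half-lines and their germs at infinity\<close>

text \<open>
  A partial function \<open>h : (u,\<infinity>) \<rightarrow> \<real>\<close> is a total function \<open>h\<close> together with its left end point
  \<open>u\<close>; the values of \<open>h\<close> outside \<open>(u,\<infinity>)\<close> are arbitrary and never used. Only open sets \<open>S\<close> occur
  below, on which \<open>(deriv ^^ k) h\<close> depends only on the values of \<open>h\<close> on \<open>S\<close>.
\<close>

definition smooth_on :: "real set \<Rightarrow> (real \<Rightarrow> real) \<Rightarrow> bool" where
  "smooth_on S f \<longleftrightarrow> (\<forall>k. \<forall>t\<in>S. ((deriv ^^ k) f) differentiable (at t))"

text \<open>
  Functions smooth on some \<open>(u,\<infinity>)\<close>; real end points suffice because \<open>(-\<infinity>,\<infinity>)\<close> contains every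
  \<open>(u,\<infinity>)\<close>.
\<close>

definition ev_smooth :: "(real \<Rightarrow> real) set" where
  "ev_smooth = {f. \<exists>u::real. smooth_on {u<..} f}"

definition germ_rel :: "((real \<Rightarrow> real) \<times> (real \<Rightarrow> real)) set" where
  "germ_rel = {(f, g). f \<in> ev_smooth \<and> g \<in> ev_smooth \<and> eventually (\<lambda>t. f t = g t) at_top}"

definition germ :: "(real \<Rightarrow> real) \<Rightarrow> (real \<Rightarrow> real) set" where
  "germ f = germ_rel `` {f}"

text \<open>
  The operations on classes are defined through all pairs of representatives; they are
  well defined by \<open>germ_mult\<close>, \<open>germ_add\<close> and \<open>germ_deriv_germ\<close> below.
\<close>

definition germ_ring :: "(real \<Rightarrow> real) set ring" where
  "germ_ring =
    \<lparr>carrier = ev_smooth // germ_rel,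
     mult = (\<lambda>X Y. \<Union>f\<in>X. \<Union>g\<in>Y. germ (\<lambda>t. f t * g t)),
     one = germ (\<lambda>t. 1),
     zero = germ (\<lambda>t. 0),
     add = (\<lambda>X Y. \<Union>f\<in>X. \<Union>g\<in>Y. germ (\<lambda>t. f t + g t))\<rparr>"

definition germ_deriv :: "(real \<Rightarrow> real) set \<Rightarrow> (real \<Rightarrow> real) set" where
  "germ_deriv X = (\<Union>f\<in>X. germ (deriv f))"

definition hardy_field :: "(real \<Rightarrow> real) set set \<Rightarrow> bool" where
  "hardy_field K \<longleftrightarrow> subfield K germ_ring \<and> (\<forall>X\<in>K. germ_deriv X \<in> K)"

definition hardy_field_function :: "ereal \<Rightarrow> (real \<Rightarrow> real) \<Rightarrow> bool" where
  "hardy_field_function u h \<longleftrightarrow>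
     u \<noteq> \<infinity> \<and> smooth_on {t. u < ereal t} h \<and> (\<exists>K. hardy_field K \<and> germ h \<in> K)"

text \<open>The infimum is taken in the extended reals, so that it also exists for the empty set.\<close>

definition growth_rate :: "(real \<Rightarrow> real) \<Rightarrow> ereal" where
  "growth_rate h = (INF \<alpha> \<in> {\<alpha>::real. eventually (\<lambda>t. \<bar>h t\<bar> \<le> t powr \<alpha>) at_top}. ereal \<alpha>)"

definition floor_values :: "ereal \<Rightarrow> (real \<Rightarrow> real) \<Rightarrow> int set" where
  "floor_values u h =
     {s * \<lfloor>h (real n)\<rfloor> | s n. s \<in> {1, -1} \<and> n \<ge> 1 \<and> u < ereal (real n)}"


section \<open>Nonnegative cosine polynomials\<close>

text \<open>
  A cosine polynomial with frequencies in \<open>F\<close> is given by its coefficients; \<open>a 0\<close> is the constant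
  coefficient. Only sets \<open>F\<close> of positive integers are used, so \<open>0 \<notin> F\<close>.
\<close>

definition cos_poly :: "int set \<Rightarrow> (int \<Rightarrow> real) \<Rightarrow> real \<Rightarrow> real" where
  "cos_poly F a \<xi> = a 0 + (\<Sum>s\<in>F. a s * cos (2 * pi * of_int s * \<xi>))"

definition nonneg_cos_polys :: "int set \<Rightarrow> (int \<Rightarrow> real) set" where
  "nonneg_cos_polys F = {a. (\<forall>\<xi>. cos_poly F a \<xi> \<ge> 0) \<and> cos_poly F a 0 = 1}"

definition cos_gamma :: "int set \<Rightarrow> nat \<Rightarrow> real" where
  "cos_gamma S N = (INF a \<in> nonneg_cos_polys (S \<inter> {1..int N}). a 0)"


section \<open>The germs form a commutative ring with a derivation\<close>

lemma higher_deriv_eq_on_open: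
  fixes f g :: "real \<Rightarrow> real"
  assumes "open S" "\<And>t. t \<in> S \<Longrightarrow> f t = g t" "t \<in> S"
  shows "(deriv ^^ k) f t = (deriv ^^ k) g t"
  using assms by (intro higher_deriv_cong_ev) (auto simp: eventually_nhds)

lemma differentiable_cong_open:
  fixes f g :: "real \<Rightarrow> real"
  assumes "open S" "\<And>t. t \<in> S \<Longrightarrow> f t = g t" "t \<in> S" "f differentiable (at t)"
  shows "g differentiable (at t)"
  using assms unfolding differentiable_def
  by (meson has_derivative_transform_within_open)

definition diff_upto :: "nat \<Rightarrow> real set \<Rightarrow> (real \<Rightarrow> real) \<Rightarrow> bool" where
  "diff_upto n S f \<longleftrightarrow> (\<forall>k\<le>n. \<forall>t\<in>S. ((deriv ^^ k) f) differentiable (at t))"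

lemma smooth_on_iff_diff_upto: "smooth_on S f \<longleftrightarrow> (\<forall>n. diff_upto n S f)"
  by (auto simp: smooth_on_def diff_upto_def)

lemma diff_upto_0: "diff_upto 0 S f \<longleftrightarrow> (\<forall>t\<in>S. f differentiable (at t))"
  by (simp add: diff_upto_def)

lemma diff_upto_Suc:
  "diff_upto (Suc n) S f \<longleftrightarrow> (\<forall>t\<in>S. f differentiable (at t)) \<and> diff_upto n S (deriv f)"
proof -
  have "(\<forall>k\<le>Suc n. P k) \<longleftrightarrow> P 0 \<and> (\<forall>k\<le>n. P (Suc k))" for P
    by (metis Suc_le_mono bot_nat_0.extremum not0_implies_Suc)
  then show ?thesis
    by (simp add: diff_upto_def funpow_Suc_right del: funpow.simps(2))
qed

lemma diff_upto_mono: "diff_upto (Suc n) S f \<Longrightarrow> diff_upto n S f"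
  by (simp add: diff_upto_def)

lemma diff_upto_cong:
  assumes "open S" "\<And>t. t \<in> S \<Longrightarrow> f t = g t" "diff_upto n S f"
  shows "diff_upto n S g"
  unfolding diff_upto_def
proof (intro allI impI ballI)
  fix k t assume "k \<le> n" "t \<in> S"
  show "(deriv ^^ k) g differentiable at t"
  proof (rule differentiable_cong_open[OF assms(1) _ \<open>t \<in> S\<close>])
    show "(deriv ^^ k) f differentiable at t"
      using assms(3) \<open>k \<le> n\<close> \<open>t \<in> S\<close> by (simp add: diff_upto_def)
    show "(deriv ^^ k) f t = (deriv ^^ k) g t" if "t \<in> S" for t
      by (rule higher_deriv_eq_on_open[OF assms(1,2) that])
  qed
qed

lemma deriv_add_real:
  fixes f g :: "real \<Rightarrow> real"
  assumes "f differentiable (at t)" "g differentiable (at t)"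
  shows "deriv (\<lambda>t. f t + g t) t = deriv f t + deriv g t"
  using assms by (intro DERIV_imp_deriv DERIV_add) (simp_all add: DERIV_deriv_iff_real_differentiable)

lemma deriv_mult_real:
  fixes f g :: "real \<Rightarrow> real"
  assumes "f differentiable (at t)" "g differentiable (at t)"
  shows "deriv (\<lambda>t. f t * g t) t = deriv f t * g t + deriv g t * f t"
  using assms by (intro DERIV_imp_deriv DERIV_mult) (simp_all add: DERIV_deriv_iff_real_differentiable)

lemma diff_upto_add:
  assumes "open S"
  shows "diff_upto n S f \<Longrightarrow> diff_upto n S g \<Longrightarrow> diff_upto n S (\<lambda>t. f t + g t)"
proof (induction n arbitrary: f g)
  case 0
  then show ?case by (simp add: diff_upto_0)
next
  case (Suc n)
  have "diff_upto n S (\<lambda>t. deriv f t + deriv g t)"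
    using Suc.prems by (intro Suc.IH) (simp_all add: diff_upto_Suc)
  then have "diff_upto n S (deriv (\<lambda>t. f t + g t))"
    by (rule diff_upto_cong[OF assms, rotated])
       (use Suc.prems in \<open>simp add: diff_upto_Suc deriv_add_real\<close>)
  then show ?case using Suc.prems by (simp add: diff_upto_Suc)
qed

lemma diff_upto_mult:
  assumes "open S"
  shows "diff_upto n S f \<Longrightarrow> diff_upto n S g \<Longrightarrow> diff_upto n S (\<lambda>t. f t * g t)"
proof (induction n arbitrary: f g)
  case 0
  then show ?case by (simp add: diff_upto_0)
next
  case (Suc n)
  have "diff_upto n S (\<lambda>t. deriv f t * g t + deriv g t * f t)"
    using Suc.prems
    by (intro diff_upto_add[OF assms] Suc.IH)
       (simp add: diff_upto_Suc, blast dest: diff_upto_mono, simp add: diff_upto_Suc, blast dest: diff_upto_mono)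
  then have "diff_upto n S (deriv (\<lambda>t. f t * g t))"
    by (rule diff_upto_cong[OF assms, rotated])
       (use Suc.prems in \<open>simp add: diff_upto_Suc deriv_mult_real\<close>)
  then show ?case using Suc.prems by (simp add: diff_upto_Suc)
qed

lemma smooth_on_const: "smooth_on S (\<lambda>t. c)"
proof -
  have "(deriv ^^ k) (\<lambda>t::real. c) = (\<lambda>t. if k = 0 then c else 0)" for k
  proof (induction k)
    case (Suc k)
    have "deriv (\<lambda>t::real. d) = (\<lambda>t. 0)" for d :: real
      by (rule ext) simp
    then show ?case by (cases "k = 0") (simp_all add: Suc.IH)
  qed simp
  then show ?thesis by (simp add: smooth_on_def)
qed

lemma ev_smooth_const: "(\<lambda>t. c) \<in> ev_smooth"
  by (simp add: ev_smooth_def smooth_on_const)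

lemma ev_smooth_binop:
  assumes "f \<in> ev_smooth" "g \<in> ev_smooth"
  shows "(\<lambda>t. f t + g t) \<in> ev_smooth" "(\<lambda>t. f t * g t) \<in> ev_smooth"
proof -
  obtain u v where uv: "smooth_on {u<..} f" "smooth_on {v<..} g"
    using assms by (auto simp: ev_smooth_def)
  define w where "w = max u v"
  have "smooth_on {w<..} f" "smooth_on {w<..} g"
    using uv by (auto simp: smooth_on_def w_def)
  then have "smooth_on {w<..} (\<lambda>t. f t + g t)" "smooth_on {w<..} (\<lambda>t. f t * g t)"
    by (auto simp: smooth_on_iff_diff_upto intro: diff_upto_add diff_upto_mult)
  then show "(\<lambda>t. f t + g t) \<in> ev_smooth" "(\<lambda>t. f t * g t) \<in> ev_smooth"
    by (auto simp: ev_smooth_def)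
qed

lemma ev_smooth_deriv: "f \<in> ev_smooth \<Longrightarrow> deriv f \<in> ev_smooth"
  unfolding ev_smooth_def smooth_on_iff_diff_upto by (blast dest: diff_upto_Suc[THEN iffD1])

lemma equiv_germ_rel: "equiv ev_smooth germ_rel"
proof (rule equivI)
  show "trans germ_rel"
    by (auto simp: trans_def germ_rel_def elim: eventually_elim2)
qed (auto simp: refl_on_def sym_def germ_rel_def eq_commute)

lemma germ_in_carrier: "f \<in> ev_smooth \<Longrightarrow> germ f \<in> carrier germ_ring"
  by (simp add: germ_ring_def germ_def quotientI)

lemma carrier_cases:
  assumes "X \<in> carrier germ_ring"
  obtains f where "f \<in> ev_smooth" "X = germ f"
  using assms by (auto simp: germ_ring_def germ_def elim: quotientE)

lemma germ_eq_iff: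
  assumes "f \<in> ev_smooth" "g \<in> ev_smooth"
  shows "germ f = germ g \<longleftrightarrow> eventually (\<lambda>t. f t = g t) at_top"
  using eq_equiv_class_iff[OF equiv_germ_rel assms] assms by (simp add: germ_def germ_rel_def)

lemma mem_germ_iff:
  "g \<in> germ f \<longleftrightarrow> f \<in> ev_smooth \<and> g \<in> ev_smooth \<and> eventually (\<lambda>t. f t = g t) at_top"
  by (simp add: germ_def germ_rel_def)

lemma UN_eq_const:
  assumes "\<And>x. x \<in> A \<Longrightarrow> F x = K" "a \<in> A"
  shows "(\<Union>x\<in>A. F x) = K"
proof -
  have "(\<Union>x\<in>A. F x) = (\<Union>x\<in>A. K)"
    by (intro SUP_cong refl assms(1))
  also have "\<dots> = K" using assms(2) by auto
  finally show ?thesis .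
qed

lemma UN_UN_eq_const:
  assumes "\<And>x y. x \<in> A \<Longrightarrow> y \<in> B \<Longrightarrow> F x y = K" "a \<in> A" "b \<in> B"
  shows "(\<Union>x\<in>A. \<Union>y\<in>B. F x y) = K"
  by (rule UN_eq_const[OF UN_eq_const[OF assms(1) assms(3)] assms(2)])

lemma germ_add:
  assumes "f \<in> ev_smooth" "g \<in> ev_smooth"
  shows "germ f \<oplus>\<^bsub>germ_ring\<^esub> germ g = germ (\<lambda>t. f t + g t)"
proof -
  have "germ (\<lambda>t. f' t + g' t) = germ (\<lambda>t. f t + g t)" if "f' \<in> germ f" "g' \<in> germ g" for f' g'
    using that unfolding mem_germ_iff
    by (subst germ_eq_iff) (auto intro: ev_smooth_binop elim: eventually_elim2)
  moreover have "f \<in> germ f" "g \<in> germ g"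
    using assms by (auto simp: mem_germ_iff)
  ultimately show ?thesis
    unfolding germ_ring_def monoid.select_convs ring.select_convs by (rule UN_UN_eq_const)
qed

lemma germ_mult:
  assumes "f \<in> ev_smooth" "g \<in> ev_smooth"
  shows "germ f \<otimes>\<^bsub>germ_ring\<^esub> germ g = germ (\<lambda>t. f t * g t)"
proof -
  have "germ (\<lambda>t. f' t * g' t) = germ (\<lambda>t. f t * g t)" if "f' \<in> germ f" "g' \<in> germ g" for f' g'
    using that unfolding mem_germ_iff
    by (subst germ_eq_iff) (auto intro: ev_smooth_binop elim: eventually_elim2)
  moreover have "f \<in> germ f" "g \<in> germ g"
    using assms by (auto simp: mem_germ_iff)
  ultimately show ?thesis
    unfolding germ_ring_def monoid.select_convs ring.select_convs by (rule UN_UN_eq_const)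
qed

lemma germ_deriv_germ:
  assumes "f \<in> ev_smooth"
  shows "germ_deriv (germ f) = germ (deriv f)"
proof -
  have "germ (deriv f') = germ (deriv f)" if f': "f' \<in> germ f" for f'
  proof -
    obtain b where b: "\<And>t. t > b \<Longrightarrow> f t = f' t"
      using f' by (auto simp: mem_germ_iff eventually_at_top_dense)
    have "deriv f' t = deriv f t" if "t > b" for t
      using higher_deriv_eq_on_open[of "{b<..}" f' f t 1] b that by simp
    then have "eventually (\<lambda>t. deriv f' t = deriv f t) at_top"
      using eventually_gt_at_top[of b] by (rule eventually_mono[rotated])
    with f' show ?thesis by (simp add: mem_germ_iff germ_eq_iff ev_smooth_deriv)
  qed
  moreover have "f \<in> germ f" using assms by (auto simp: mem_germ_iff)
  ultimately show ?thesis unfolding germ_deriv_def by (rule UN_eq_const)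
qed

lemma germ_ring_one: "\<one>\<^bsub>germ_ring\<^esub> = germ (\<lambda>t. 1)"
  and germ_ring_zero: "\<zero>\<^bsub>germ_ring\<^esub> = germ (\<lambda>t. 0)"
  by (simp_all add: germ_ring_def)

lemma cring_germ_ring: "cring germ_ring"
proof -
  note [simp] = germ_ring_one germ_ring_zero germ_add germ_mult germ_in_carrier
    ev_smooth_const ev_smooth_binop
  have neg: "\<exists>Y\<in>carrier germ_ring. Y \<oplus>\<^bsub>germ_ring\<^esub> X = \<zero>\<^bsub>germ_ring\<^esub>"
    if X: "X \<in> carrier germ_ring" for X
  proof -
    obtain f where f: "f \<in> ev_smooth" "X = germ f" using X by (rule carrier_cases)
    have m: "(\<lambda>t. - 1 * f t) \<in> ev_smooth"
      using f(1) by (intro ev_smooth_binop ev_smooth_const)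
    show ?thesis
      by (rule bexI[OF _ germ_in_carrier[OF m]]) (simp only: f germ_add[OF m f(1)], simp)
  qed
  show ?thesis
  proof (intro cringI abelian_groupI comm_monoidI)
    fix X Y Z assume X: "X \<in> carrier germ_ring" and Y: "Y \<in> carrier germ_ring"
      and Z: "Z \<in> carrier germ_ring"
    obtain f g k where [simp]: "f \<in> ev_smooth" "X = germ f" "g \<in> ev_smooth" "Y = germ g"
      "k \<in> ev_smooth" "Z = germ k"
      using X Y Z by (metis carrier_cases)
    show "(X \<oplus>\<^bsub>germ_ring\<^esub> Y) \<oplus>\<^bsub>germ_ring\<^esub> Z = X \<oplus>\<^bsub>germ_ring\<^esub> (Y \<oplus>\<^bsub>germ_ring\<^esub> Z)"
      "(X \<otimes>\<^bsub>germ_ring\<^esub> Y) \<otimes>\<^bsub>germ_ring\<^esub> Z = X \<otimes>\<^bsub>germ_ring\<^esub> (Y \<otimes>\<^bsub>germ_ring\<^esub> Z)"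
      "(X \<oplus>\<^bsub>germ_ring\<^esub> Y) \<otimes>\<^bsub>germ_ring\<^esub> Z
        = (X \<otimes>\<^bsub>germ_ring\<^esub> Z) \<oplus>\<^bsub>germ_ring\<^esub> (Y \<otimes>\<^bsub>germ_ring\<^esub> Z)"
      by (simp_all add: algebra_simps)
  next
    fix X Y assume X: "X \<in> carrier germ_ring" and Y: "Y \<in> carrier germ_ring"
    obtain f g where [simp]: "f \<in> ev_smooth" "X = germ f" "g \<in> ev_smooth" "Y = germ g"
      using X Y by (metis carrier_cases)
    show "X \<oplus>\<^bsub>germ_ring\<^esub> Y = Y \<oplus>\<^bsub>germ_ring\<^esub> X" "X \<otimes>\<^bsub>germ_ring\<^esub> Y = Y \<otimes>\<^bsub>germ_ring\<^esub> X"
      "X \<oplus>\<^bsub>germ_ring\<^esub> Y \<in> carrier germ_ring" "X \<otimes>\<^bsub>germ_ring\<^esub> Y \<in> carrier germ_ring"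
      by (simp_all add: algebra_simps)
  next
    fix X assume "X \<in> carrier germ_ring"
    then obtain f where [simp]: "f \<in> ev_smooth" "X = germ f" by (rule carrier_cases)
    show "\<zero>\<^bsub>germ_ring\<^esub> \<oplus>\<^bsub>germ_ring\<^esub> X = X" "\<one>\<^bsub>germ_ring\<^esub> \<otimes>\<^bsub>germ_ring\<^esub> X = X"
      by simp_all
  qed (use neg in auto)
qed

end

theory Submission
  imports Defs
begin

text \<open>
  Write \<open>\<gamma> = 1 / c\<close> and \<open>e(x) = exp (2 \<pi> i x)\<close>. After replacing \<open>h\<close> by \<open>\<bar>h\<bar>\<close>, let \<open>\<phi>\<close> be its inverse
  near infinity, so that \<open>\<phi>(x)\<close> is about \<open>x powr \<gamma>\<close>. A positive integer \<open>m\<close> is a value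
  \<open>\<lfloor>h n\<rfloor>\<close> as soon as an integer lies strictly between \<open>\<phi>(m)\<close> and \<open>\<phi>(m + 1)\<close>, an interval of length about
  \<open>\<phi>'(m)\<close>. (If \<open>h\<close> is negative, \<open>- \<lfloor>h n\<rfloor>\<close> is a ceiling, and \<open>\<phi>(m - 1)\<close> takes the place of \<open>\<phi>(m)\<close>.)
  Let \<open>W\<close> be the 1-periodic tent function of height and half-width \<open>\<delta>\<close>, where \<open>4 \<delta>\<close> is at most each of these lengths
  for \<open>m \<le> N\<close>. Then the weights \<open>W(\<phi>(m) + 2 \<delta>)\<close> vanish unless \<open>m\<close> is such a value, and the cosine polynomial

    \<open>\<Sum>m<N. (1 - m / N) W(\<phi>(m) + 2 \<delta>) cos (2 \<pi> m \<xi>)\<close>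

  has frequencies in \<open>S\<close> only. The Fourier series of \<open>W\<close> has mean \<open>\<delta>\<^sup>2\<close> and its \<open>k\<close>-th coefficient is at most
  \<open>1 / k\<^sup>2\<close>, whatever \<open>\<delta>\<close> is. The mean contributes \<open>\<delta>\<^sup>2\<close> times half of a Fejer kernel without its constant term,
  up to a bounded number of terms; that is at least \<open>- O(\<delta>\<^sup>2)\<close> everywhere and about \<open>\<delta>\<^sup>2 N / 2\<close> at \<open>\<xi> = 0\<close>. The other terms lead to the sums
  \<open>\<Sum>m. e(k \<phi>(m) \<plusminus> m \<xi>)\<close>. Here the linear phase does not affect second differences, so van der Corput's
  second-derivative test, \<open>van_der_Corput_second_difference\<close>, bounds them by \<open>O(sqrt (k / \<Lambda>))\<close> uniformly in \<open>\<xi>\<close>,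
  where \<open>\<Lambda>\<close> is a lower bound for \<open>- \<phi>''\<close> up to \<open>N\<close>. Since \<open>\<Sum>k. k powr (- 3 / 2)\<close> converges, adding a
  constant \<open>E = O(\<delta>\<^sup>2 + 1 / sqrt \<Lambda>)\<close> makes the polynomial nonnegative, and after normalising at \<open>0\<close> its constant
  coefficient is \<open>O(1 / N + 1 / (\<delta>\<^sup>2 sqrt \<Lambda> N))\<close>: this is \<open>cos_gamma_le_of_concave_inverse\<close>.

  With \<open>\<delta>\<close> of order \<open>N powr (\<gamma> - 1 - \<eta>)\<close> and \<open>\<Lambda>\<close> of order \<open>N powr (\<gamma> - 2 - \<eta>)\<close> the result is
  \<open>N powr (2 - 5 / 2 * \<gamma> + 5 / 2 * \<eta>)\<close>. For \<open>\<gamma> > 5 / 6\<close> and \<open>\<eta> = 1 / 30\<close> this is at most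
  \<open>N powr (1 - 6 / 5 * \<gamma>)\<close>.

  The sizes of \<open>\<phi>'\<close> and \<open>\<phi>''\<close> come from the Hardy field. For a rational number \<open>q\<close> the germ of
  \<open>h'\<^sup>2 - h h'' - q h'\<^sup>2\<close> lies in the field, hence has eventually constant sign; that sign compares
  \<open>(h / h')'\<close> with \<open>q\<close>. Integrating, one sees that \<open>h\<close> grows at most, or at least, like \<open>t powr (1 / q)\<close>, so
  the growth rate decides the sign: \<open>(h / h')'\<close> tends to \<open>\<gamma>\<close>. In terms of \<open>\<phi>\<close> this says
  \<open>x \<phi>''(x) / \<phi>'(x) \<rightarrow> \<gamma> - 1\<close>, which gives the two sizes.

  For a difference-free set \<open>A\<close>, averaging a nonnegative cosine polynomial against \<open>\<bar>\<Sum>a\<in>A. e(a \<xi>)\<bar>\<^sup>2\<close> over the points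
  \<open>j / (2 N)\<close> keeps the constant coefficient only, and positivity at the point \<open>0\<close> gives
  \<open>card A \<le> 2 N \<gamma>\<^sub>S(N)\<close>.
\<close>

section \<open>Nonnegative cosine polynomials and difference-free sets\<close>

lemma sum_cos_grid_eq_0:
  fixes d :: int and M :: nat
  assumes "M > 0" "\<not> int M dvd d"
  shows "(\<Sum>j<M. cos (2 * pi * of_int d * (real j / real M))) = 0"
proof -
  define z where "z = cis (2 * pi * of_int d / real M)"
  have "z \<noteq> 1"
  proof
    assume "z = 1"
    then have "cos (2 * pi * of_int d / real M) = 1"
      by (metis z_def cis.sel(1) one_complex.sel(1))
    then obtain n :: int where n: "2 * pi * of_int d / real M = of_int n * 2 * pi"
      using cos_one_2pi_int by blast
    then have "real_of_int d = of_int n * real M"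
      using assms(1) by (simp add: field_simps)
    then have "d = n * int M"
      by (metis of_int_eq_iff of_int_mult of_int_of_nat_eq)
    with assms(2) show False by simp
  qed
  moreover have "z ^ M = 1"
  proof -
    have "z ^ M = cis (real M * (2 * pi * of_int d / real M))"
      unfolding z_def by (rule Complex.DeMoivre)
    also have "real M * (2 * pi * of_int d / real M) = 2 * pi * of_int d"
      using assms(1) by simp
    finally show ?thesis by simp
  qed
  ultimately have "(\<Sum>j<M. z ^ j) = 0"
    by (simp add: geometric_sum)
  then have "Re (\<Sum>j<M. z ^ j) = 0" by simp
  moreover have "Re (z ^ j) = cos (2 * pi * of_int d * (real j / real M))" for j
    unfolding z_def cos_n_Re_cis_pow_n[symmetric] by (simp add: mult_ac)
  ultimately show ?thesis by simp
qed

lemma cos_grid_orthogonality: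
  fixes s d :: int and M :: nat
  assumes "M > 0" "\<not> int M dvd s + d" "\<not> int M dvd s - d"
  shows "(\<Sum>j<M. cos (2 * pi * of_int s * (real j / real M)) * cos (2 * pi * of_int d * (real j / real M))) = 0"
proof -
  have "cos (2 * pi * of_int s * t) * cos (2 * pi * of_int d * t)
    = (cos (2 * pi * of_int (s - d) * t) + cos (2 * pi * of_int (s + d) * t)) / 2" for t :: real
    by (simp add: cos_times_cos ring_distribs)
  then have "(\<Sum>j<M. cos (2 * pi * of_int s * (real j / real M)) * cos (2 * pi * of_int d * (real j / real M)))
    = (\<Sum>j<M. (cos (2 * pi * of_int (s - d) * (real j / real M)) + cos (2 * pi * of_int (s + d) * (real j / real M))) / 2)"
    by (intro sum.cong refl)
  also have "\<dots> = ((\<Sum>j<M. cos (2 * pi * of_int (s - d) * (real j / real M)))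
      + (\<Sum>j<M. cos (2 * pi * of_int (s + d) * (real j / real M)))) / 2"
    by (simp only: sum_divide_distrib[symmetric] sum.distrib)
  finally show ?thesis
    using assms sum_cos_grid_eq_0[of M "s - d"] sum_cos_grid_eq_0[of M "s + d"] by simp
qed

text \<open>
  Modulo \<open>2 N\<close> a difference of two elements of \<open>A\<close> agrees with \<open>\<plusminus>s\<close> for some \<open>s \<in> {1..N}\<close> only if the two are
  equal as integers. On the grid of points \<open>j / (2 N)\<close> the nonconstant part of the polynomial is therefore orthogonal to
  \<open>\<bar>\<Sum>a\<in>A. e(a \<xi>)\<bar>\<^sup>2\<close>.
\<close>
lemma card_difference_free_le:
  fixes A :: "int set" and N :: nat
  assumes a: "a \<in> nonneg_cos_polys (S \<inter> {1..int N})"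
    and A: "A \<subseteq> {1..int N}" "A \<noteq> {}"
    and diff: "\<And>x y. x \<in> A \<Longrightarrow> y \<in> A \<Longrightarrow> y - x \<notin> S \<inter> {1..int N}"
  shows "real (card A) \<le> 2 * real N * a 0"
proof -
  define F where "F = S \<inter> {1..int N}"
  define M where "M = 2 * N"
  define t where "t = (\<lambda>j::nat. real j / real M)"
  define P where "P = (\<lambda>\<xi>::real. \<Sum>x\<in>A. \<Sum>y\<in>A. cos (2 * pi * of_int (x - y) * \<xi>))"
  have finA: "finite A" using A(1) finite_subset by blast
  have M: "M > 0" using A by (auto simp: M_def)
  have P_eq: "P \<xi> = (\<Sum>x\<in>A. cos (2 * pi * of_int x * \<xi>))\<^sup>2 + (\<Sum>x\<in>A. sin (2 * pi * of_int x * \<xi>))\<^sup>2" for \<xi>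
    unfolding P_def power2_eq_square sum_product sum.distrib[symmetric]
    by (simp add: cos_diff[symmetric] algebra_simps)
  have P_nonneg: "P \<xi> \<ge> 0" for \<xi> unfolding P_eq by simp
  have T: "cos_poly F a \<xi> \<ge> 0" "cos_poly F a 0 = 1" for \<xi>
    using a by (auto simp: nonneg_cos_polys_def F_def)
  have grid: "(\<Sum>j<M. cos_poly F a (t j) * cos (2 * pi * of_int (x - y) * t j))
      = (if x = y then a 0 * real M else 0)" if "x \<in> A" "y \<in> A" for x y
  proof -
    have "(\<Sum>j<M. cos_poly F a (t j) * cos (2 * pi * of_int (x - y) * t j))
      = a 0 * (\<Sum>j<M. cos (2 * pi * of_int (x - y) * t j))
        + (\<Sum>s\<in>F. a s * (\<Sum>j<M. cos (2 * pi * of_int s * t j) * cos (2 * pi * of_int (x - y) * t j)))"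
      unfolding cos_poly_def
      by (simp add: distrib_right sum.distrib sum_distrib_left sum_distrib_right mult.assoc
          sum.swap[of _ F])
    moreover have "(\<Sum>j<M. cos (2 * pi * of_int s * t j) * cos (2 * pi * of_int (x - y) * t j)) = 0"
      if "s \<in> F" for s
      unfolding t_def
    proof (rule cos_grid_orthogonality[OF M])
      have s: "1 \<le> s" "s \<le> int N" using that by (auto simp: F_def)
      have xy: "x \<in> {1..int N}" "y \<in> {1..int N}" using A(1) \<open>x \<in> A\<close> \<open>y \<in> A\<close> by auto
      have ne: "y - x \<noteq> s" "x - y \<noteq> s"
        using diff that \<open>x \<in> A\<close> \<open>y \<in> A\<close> unfolding F_def by metis+
      have small: "\<not> int M dvd e" if "e \<noteq> 0" "\<bar>e\<bar> < int M" for e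
        using that by (metis abs_of_nat dvd_imp_le_int linorder_not_less)
      show "\<not> int M dvd s + (x - y)" using s xy ne by (intro small) (auto simp: M_def)
      show "\<not> int M dvd s - (x - y)" using s xy ne by (intro small) (auto simp: M_def)
    qed
    moreover have "(\<Sum>j<M. cos (2 * pi * of_int (x - y) * t j)) = (if x = y then real M else 0)"
    proof (cases "x = y")
      case False
      have "x \<in> {1..int N}" "y \<in> {1..int N}" using A(1) that by auto
      then have "\<bar>x - y\<bar> < int M" by (auto simp: M_def)
      then have "\<not> int M dvd x - y"
        using False by (metis abs_of_nat dvd_imp_le_int eq_iff_diff_eq_0 linorder_not_less)
      then show ?thesis using False sum_cos_grid_eq_0[OF M, of "x - y"] by (simp add: t_def)
    qed simp
    ultimately show ?thesis by simp
  qed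
  \<comment> \<open>Keep only the grid point \<open>0\<close>, where the polynomial is \<open>1\<close>; the other points contribute nonnegative terms.\<close>
  have "real (card A) ^ 2 = cos_poly F a (t 0) * P (t 0)"
    by (simp add: T t_def P_def power2_eq_square)
  also have "\<dots> \<le> (\<Sum>j<M. cos_poly F a (t j) * P (t j))"
    using M by (intro member_le_sum) (auto simp: T P_nonneg)
  also have "\<dots> = (\<Sum>x\<in>A. \<Sum>y\<in>A. \<Sum>j<M. cos_poly F a (t j) * cos (2 * pi * of_int (x - y) * t j))"
    unfolding P_def sum_distrib_left by (simp add: sum.swap[of _ "{..<M}"])
  also have "\<dots> = (\<Sum>x\<in>A. \<Sum>y\<in>A. if x = y then a 0 * real M else 0)"
    by (intro sum.cong refl grid)
  also have "\<dots> = real (card A) * (a 0 * real M)"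
    using finA by simp
  finally have "real (card A) * real (card A) \<le> real (card A) * (a 0 * real M)"
    by (simp add: power2_eq_square)
  moreover have "real (card A) > 0" using finA A(2) by (simp add: card_gt_0_iff)
  ultimately show ?thesis by (simp add: M_def mult_ac)
qed

text \<open>A single point is difference-free.\<close>
lemma constant_coeff_nonneg:
  assumes "a \<in> nonneg_cos_polys (S \<inter> {1..int N})" "N \<ge> 1"
  shows "0 \<le> a 0"
proof -
  have "real (card {1::int}) \<le> 2 * real N * a 0"
    by (rule card_difference_free_le[OF assms(1)]) (use assms(2) in auto)
  then have "0 < real N * a 0" by simp
  then show ?thesis using assms(2) by (simp add: zero_less_mult_iff)
qed

lemma nonneg_cos_polys_nonempty: "nonneg_cos_polys (S \<inter> {1..int N}) \<noteq> {}"
proof -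
  have "cos_poly (S \<inter> {1..int N}) (\<lambda>s. of_bool (s = 0)) \<xi> = 1" for \<xi>
    unfolding cos_poly_def by (subst sum.neutral) auto
  then have "(\<lambda>s. of_bool (s = 0)) \<in> nonneg_cos_polys (S \<inter> {1..int N})"
    by (simp add: nonneg_cos_polys_def)
  then show ?thesis by blast
qed

lemma cos_gamma_nonneg:
  assumes "N \<ge> 1"
  shows "0 \<le> cos_gamma S N"
  unfolding cos_gamma_def
  by (rule cINF_greatest[OF nonneg_cos_polys_nonempty]) (rule constant_coeff_nonneg[OF _ assms])

lemma cos_gamma_le:
  assumes "a \<in> nonneg_cos_polys (S \<inter> {1..int N})" "N \<ge> 1"
  shows "cos_gamma S N \<le> a 0"
  unfolding cos_gamma_def
  by (rule cINF_lower[OF _ assms(1)]) (auto intro!: bdd_belowI2 constant_coeff_nonneg[OF _ assms(2)])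

lemma card_difference_free_le_cos_gamma:
  fixes A :: "int set" and N :: nat
  assumes A: "A \<subseteq> {1..int N}" and N: "N \<ge> 1"
    and diff: "\<And>x y. x \<in> A \<Longrightarrow> y \<in> A \<Longrightarrow> y - x \<notin> S \<inter> {1..int N}"
  shows "real (card A) \<le> 2 * real N * cos_gamma S N"
proof (cases "A = {}")
  case True
  then show ?thesis using cos_gamma_nonneg[OF N] by simp
next
  case False
  have "real (card A) / (2 * real N) \<le> cos_gamma S N"
    unfolding cos_gamma_def
    using card_difference_free_le[OF _ A False diff] N
    by (intro cINF_greatest[OF nonneg_cos_polys_nonempty]) (auto simp: field_simps)
  then show ?thesis using N by (simp add: field_simps)
qed

section \<open>The Fourier series of a tent function\<close>

text \<open>
  The real part of the dilogarithm at \<open>r e(x)\<close>; the term with index \<open>0\<close> vanishes because \<open>1 / 0 = 0\<close>. On the unit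
  circle it is the series \<open>\<Sum>k. cos (2 \<pi> k x) / k\<^sup>2\<close>, whose termwise derivative no longer converges absolutely;
  the radius \<open>r < 1\<close> regularises it.
\<close>
definition dilog_cos :: "real \<Rightarrow> real \<Rightarrow> real" where
  "dilog_cos r x = (\<Sum>n. r ^ n * cos (2 * pi * real n * x) / (real n)\<^sup>2)"

lemma summable_inverse_squares: "summable (\<lambda>n. 1 / (real n)\<^sup>2)"
  using inverse_power_summable[of 2, where 'a = real] by (simp add: field_simps)

lemma dilog_cos_term_le: "\<bar>r\<bar> \<le> 1 \<Longrightarrow> \<bar>r ^ n * cos (2 * pi * real n * x) / (real n)\<^sup>2\<bar> \<le> 1 / (real n)\<^sup>2"
  by (auto simp: abs_mult power_abs intro!: divide_right_mono mult_le_one power_le_one abs_cos_le_one)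

lemma dilog_cos_summable:
  assumes "\<bar>r\<bar> \<le> 1"
  shows "summable (\<lambda>n. r ^ n * cos (2 * pi * real n * x) / (real n)\<^sup>2)"
  by (rule summable_comparison_test'[OF summable_inverse_squares])
     (use dilog_cos_term_le[OF assms] in auto)

lemma dilog_cos_continuous_in_radius: "continuous_on {0..1} (\<lambda>r. dilog_cos r x)"
proof -
  have "uniform_limit {0..1} (\<lambda>n r. \<Sum>i<n. r ^ i * cos (2 * pi * real i * x) / (real i)\<^sup>2)
     (\<lambda>r. dilog_cos r x) sequentially"
    unfolding dilog_cos_def
    using dilog_cos_term_le by (intro Weierstrass_m_test[OF _ summable_inverse_squares]) auto
  moreover have "continuous_on {0..1} (\<lambda>r. r ^ i * cos (2 * pi * real i * x) / (real i)\<^sup>2)" for i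
    by (cases "i = 0") (auto intro!: continuous_intros)
  ultimately show ?thesis
    by (intro uniform_limit_theorem) (auto intro!: always_eventually continuous_on_sum)
qed

lemma dilog_cos_derivative:
  assumes "0 \<le> r" "r < 1"
  shows "(dilog_cos r has_real_derivative 2 * pi * Im (Ln (1 - of_real r * cis (2 * pi * x)))) (at x)"
proof -
  define c where "c = (\<lambda>n. 1 / (of_nat n)\<^sup>2 :: complex)"
  define L where "L = (\<lambda>z::complex. \<Sum>n. c n * z ^ n)"
  define \<zeta> where "\<zeta> = (\<lambda>x. of_real r * cis (2 * pi * x))"
  have \<zeta>1: "norm (\<zeta> x) < 1" for x using assms by (simp add: \<zeta>_def norm_mult)
  have summ: "summable (\<lambda>n. c n * z ^ n)" if "norm z < 1" for z
  proof (rule summable_comparison_test'[OF summable_inverse_squares])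
    show "norm (c n * z ^ n) \<le> 1 / (real n)\<^sup>2" for n
      using that by (simp add: c_def norm_mult norm_divide norm_power power_le_one divide_right_mono)
  qed
  have L': "(L has_field_derivative (\<Sum>n. diffs c n * z ^ n)) (at z)" if "norm z < 1" for z
    unfolding L_def by (rule termdiffs_strong'[OF summ that])
  have Ln: "z * (\<Sum>n. diffs c n * z ^ n) = - Ln (1 - z)" if "norm z < 1" for z
  proof -
    have "(\<lambda>n. - ((- (- z)) ^ n) / of_nat n) sums ln (1 + (- z))"
      by (rule Ln_series') (use that in simp)
    then have "(\<lambda>n. z ^ n / of_nat n) sums (- ln (1 - z))"
      using sums_minus by fastforce
    then have "(\<lambda>n. z ^ Suc n / of_nat (Suc n)) sums (- ln (1 - z))"
      by (subst sums_Suc_iff) simp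
    moreover have "z ^ Suc n / of_nat (Suc n) = z * (diffs c n * z ^ n)" for n
      by (simp add: diffs_def c_def power2_eq_square del: of_nat_Suc)
    ultimately have *: "(\<lambda>n. z * (diffs c n * z ^ n)) sums (- ln (1 - z))" by simp
    have "summable (\<lambda>n. diffs c n * z ^ n)"
      by (rule termdiff_converges[OF that summ])
    from suminf_mult[OF this, of z] sums_unique[OF *] show ?thesis by simp
  qed
  have "(\<zeta> has_vector_derivative (2 * pi * \<i> * \<zeta> x)) (at x)"
    unfolding \<zeta>_def cis_conv_exp
    by (rule has_vector_derivative_real_field | auto intro!: derivative_eq_intros)+
  then have "((L \<circ> \<zeta>) has_vector_derivative (2 * pi * \<i> * \<zeta> x * (\<Sum>n. diffs c n * \<zeta> x ^ n))) (at x)"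
    by (rule field_vector_diff_chain_at) (rule L'[OF \<zeta>1])
  also have "2 * pi * \<i> * \<zeta> x * (\<Sum>n. diffs c n * \<zeta> x ^ n) = 2 * pi * \<i> * (- Ln (1 - \<zeta> x))"
    using Ln[OF \<zeta>1, of x] by (simp add: mult.assoc)
  finally have "((\<lambda>x. Re ((L \<circ> \<zeta>) x)) has_vector_derivative Re (2 * pi * \<i> * (- Ln (1 - \<zeta> x)))) (at x)"
    by (rule bounded_linear.has_vector_derivative[OF bounded_linear_Re])
  moreover have "Re ((L \<circ> \<zeta>) x) = dilog_cos r x" for x
  proof -
    have "(\<lambda>n. Re (c n * \<zeta> x ^ n)) sums Re (L (\<zeta> x))"
      unfolding L_def by (intro sums_Re summable_sums summ \<zeta>1)
    moreover have "Re (c n * \<zeta> x ^ n) = r ^ n * cos (2 * pi * real n * x) / (real n)\<^sup>2" for n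
    proof -
      have "c n = of_real (1 / (real n)\<^sup>2)" by (simp add: c_def)
      then have "c n * \<zeta> x ^ n = of_real (r ^ n / (real n)\<^sup>2) * cis (real n * (2 * pi * x))"
        by (simp add: \<zeta>_def power_mult_distrib Complex.DeMoivre)
      then show ?thesis by (simp add: mult_ac)
    qed
    ultimately show ?thesis by (simp add: dilog_cos_def sums_iff)
  qed
  ultimately show ?thesis
    by (simp add: has_real_derivative_iff_has_vector_derivative \<zeta>_def)
qed

lemma Im_Ln_one_minus_cis:
  assumes "0 < x" "x < 1"
  shows "Im (Ln (1 - cis (2 * pi * x))) = pi * x - pi / 2"
proof -
  have s: "sin (pi * x) > 0" using assms by (intro sin_gt_zero) auto
  define w where "w = Complex (ln (2 * sin (pi * x))) (pi * x - pi / 2)"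
  have "exp w = 1 - cis (2 * pi * x)"
    using s cos_double_sin[of "pi * x"] sin_double[of "pi * x"]
    by (simp add: w_def complex_eq_iff exp_eq_polar cos_diff sin_diff power2_eq_square mult_ac)
  moreover have "Ln (exp w) = w"
  proof (rule Ln_exp)
    have "0 < pi * x" "pi * x < pi"
      using assms mult_strict_left_mono[of x 1 pi] by simp_all
    then show "- pi < Im w" "Im w \<le> pi" unfolding w_def complex.sel using pi_gt_zero by linarith+
  qed
  ultimately show ?thesis by (metis w_def complex.sel(2))
qed

text \<open>
  Up to an additive constant this is the Fourier series of the second Bernoulli polynomial. For \<open>r < 1\<close> the
  derivative in \<open>x\<close> is \<open>2 \<pi> Im (Ln (1 - r e(x)))\<close>, and as \<open>r\<close> tends to \<open>1\<close> this tends to \<open>\<pi>\<^sup>2 (2 x - 1)\<close>, uniformly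
  on compact subintervals of \<open>(0, 1)\<close>, because \<open>Ln\<close> is continuous away from the cut.
\<close>
lemma dilog_cos_1_quadratic:
  assumes x: "0 < x" "x < 1" and y: "0 < y" "y < 1"
  shows "dilog_cos 1 x - pi\<^sup>2 * (x\<^sup>2 - x) = dilog_cos 1 y - pi\<^sup>2 * (y\<^sup>2 - y)"
proof -
  define I where "I = {min x y..max x y}"
  have I: "x \<in> I" "y \<in> I" "\<And>t. t \<in> I \<Longrightarrow> 0 < t \<and> t < 1" "compact I" "convex I"
    using x y by (auto simp: I_def)
  define \<psi> where "\<psi> = (\<lambda>p::real \<times> real. Im (Ln (1 - of_real (fst p) * cis (2 * pi * snd p))))"
  \<comment> \<open>The claim is \<open>K 1 = 0\<close>; it is obtained as the limit of \<open>K r\<close> for \<open>r\<close> tending to \<open>1\<close> from below.\<close>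
  define K where "K = (\<lambda>r. (dilog_cos r x - pi\<^sup>2 * (x\<^sup>2 - x)) - (dilog_cos r y - pi\<^sup>2 * (y\<^sup>2 - y)))"
  have "continuous_on ({0..1} \<times> I) \<psi>"
  proof -
    have "1 - of_real r * cis (2 * pi * t) \<notin> \<real>\<^sub>\<le>\<^sub>0" if "r \<in> {0..1}" "t \<in> I" for r t
    proof
      assume "1 - of_real r * cis (2 * pi * t) \<in> \<real>\<^sub>\<le>\<^sub>0"
      then have 1: "1 \<le> r * cos (2 * pi * t)"
        by (simp add: complex_nonpos_Reals_iff)
      have "r * cos (2 * pi * t) \<le> 1 * cos (2 * pi * t) \<or> r * cos (2 * pi * t) \<le> 0"
        using that(1) mult_right_mono[of r 1 "cos (2 * pi * t)"] by (cases "cos (2 * pi * t) \<ge> 0")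
          (auto simp: mult_le_0_iff)
      then have "cos (2 * pi * t) = 1" using 1 cos_le_one[of "2 * pi * t"] by linarith
      then obtain n :: int where "2 * pi * t = of_int n * 2 * pi" using cos_one_2pi_int by blast
      then have "t = of_int n" by simp
      with I(3)[OF that(2)] show False by (simp add: of_int_0_less_iff) linarith
    qed
    then show ?thesis
      unfolding \<psi>_def by (auto intro!: continuous_intros)
  qed
  then have uc: "uniformly_continuous_on ({0..1} \<times> I) \<psi>"
    by (intro compact_uniformly_continuous compact_Times I) auto
  have K_small: "\<exists>d>0. \<forall>r. 1 - d < r \<and> 0 \<le> r \<and> r < 1 \<longrightarrow> \<bar>K r\<bar> \<le> 2 * pi * e" if "e > 0" for e
  proof -
    obtain d where d: "d > 0" "\<And>p q. p \<in> {0..1} \<times> I \<Longrightarrow> q \<in> {0..1} \<times> I \<Longrightarrow> dist q p < d \<Longrightarrow> dist (\<psi> q) (\<psi> p) < e"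
      using uc \<open>e > 0\<close> unfolding uniformly_continuous_on_def by metis
    show ?thesis
    proof (intro exI[of _ d] conjI allI impI \<open>d > 0\<close>)
      fix r assume r: "1 - d < r \<and> 0 \<le> r \<and> r < 1"
      have "norm ((dilog_cos r x - pi\<^sup>2 * (x\<^sup>2 - x)) - (dilog_cos r y - pi\<^sup>2 * (y\<^sup>2 - y)))
          \<le> 2 * pi * e * norm (x - y)"
      proof (rule field_differentiable_bound[OF \<open>convex I\<close> _ _ I(1,2)])
        fix t assume t: "t \<in> I"
        show "((\<lambda>t. dilog_cos r t - pi\<^sup>2 * (t\<^sup>2 - t)) has_field_derivative
            2 * pi * (\<psi> (r, t) - \<psi> (1, t))) (at t within I)"
        proof (rule has_field_derivative_at_within)
          have \<psi>1: "\<psi> (1, t) = pi * t - pi / 2"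
            using I(3)[OF t] Im_Ln_one_minus_cis[of t] by (simp add: \<psi>_def)
          have eq: "2 * pi * (\<psi> (r, t) - \<psi> (1, t)) = 2 * pi * \<psi> (r, t) - pi\<^sup>2 * (2 * t - 1)"
            unfolding \<psi>1 by (simp add: field_simps power2_eq_square)
          have "(dilog_cos r has_real_derivative 2 * pi * \<psi> (r, t)) (at t)"
            unfolding \<psi>_def fst_conv snd_conv using r by (intro dilog_cos_derivative) auto
          then show "((\<lambda>t. dilog_cos r t - pi\<^sup>2 * (t\<^sup>2 - t)) has_field_derivative
            2 * pi * (\<psi> (r, t) - \<psi> (1, t))) (at t)"
            unfolding eq by (auto intro!: derivative_eq_intros)
        qed
        have "dist (\<psi> (r, t)) (\<psi> (1, t)) < e"
          using r t by (intro d(2)) (auto simp: dist_Pair_Pair dist_real_def)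
        then show "norm (2 * pi * (\<psi> (r, t) - \<psi> (1, t))) \<le> 2 * pi * e"
          by (simp add: abs_mult dist_real_def)
      qed
      also have "\<dots> \<le> 2 * pi * e"
        using x y \<open>e > 0\<close> by (simp add: abs_if mult_le_cancel_left1)
      finally show "\<bar>K r\<bar> \<le> 2 * pi * e" by (simp add: K_def)
    qed
  qed
  have "continuous_on {0..1} K"
    unfolding K_def by (intro continuous_intros dilog_cos_continuous_in_radius)
  then have "(K \<longlongrightarrow> K 1) (at 1 within {0..1})" by (simp add: continuous_on_def)
  then have lim: "((\<lambda>r. \<bar>K r\<bar>) \<longlongrightarrow> \<bar>K 1\<bar>) (at_left 1)"
    by (intro tendsto_intros) (simp add: at_within_Icc_at_left)
  have "\<bar>K 1\<bar> \<le> 2 * pi * e" if "e > 0" for e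
  proof (rule tendsto_upperbound[OF lim])
    obtain d where d: "d > 0" "\<And>r. 1 - d < r \<Longrightarrow> 0 \<le> r \<Longrightarrow> r < 1 \<Longrightarrow> \<bar>K r\<bar> \<le> 2 * pi * e"
      using K_small[OF \<open>e > 0\<close>] by blast
    have "eventually (\<lambda>r. r \<in> {max 0 (1 - d)<..<1}) (at_left (1::real))"
      using d(1) by (intro eventually_at_left_real) auto
    then show "eventually (\<lambda>r. \<bar>K r\<bar> \<le> 2 * pi * e) (at_left 1)"
      by eventually_elim (auto intro: d(2))
  qed simp
  then have "\<bar>K 1\<bar> \<le> 0 + e" if "e > 0" for e
    using that pi_gt_zero by (metis add_0 divide_pos_pos mult_2 nonzero_mult_div_cancel_left
        order_less_irrefl times_divide_eq_right zero_less_mult_iff zero_less_numeral)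
  then have "\<bar>K 1\<bar> \<le> 0" by (rule field_le_epsilon)
  then show ?thesis by (simp add: K_def)
qed

text \<open>
  For \<open>0 < \<delta> \<le> 1 / 2\<close> these are the cosine coefficients of the 1-periodic function \<open>max 0 (\<delta> - \<parallel>x\<parallel>)\<close>, where
  \<open>\<parallel>x\<parallel>\<close> is the distance to the nearest integer. They come from a second difference with step \<open>\<delta>\<close> of the dilogarithm
  series, and \<open>\<delta>\<^sup>2\<close> is the mean.
\<close>
definition tent_coeff :: "real \<Rightarrow> nat \<Rightarrow> real" where
  "tent_coeff \<delta> n = (1 - cos (2 * pi * real n * \<delta>)) / (pi\<^sup>2 * (real n)\<^sup>2)"

definition tent :: "real \<Rightarrow> real \<Rightarrow> real" where
  "tent \<delta> x = \<delta>\<^sup>2 + (\<Sum>n. tent_coeff \<delta> n * cos (2 * pi * real n * x))"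

lemma abs_tent_coeff_le: "\<bar>tent_coeff \<delta> n\<bar> \<le> 1 / (real n)\<^sup>2"
proof (cases "n = 0")
  case False
  have "2 \<le> pi\<^sup>2" using pi_ge_two power_mono[of 2 pi 2] by simp
  moreover have "0 \<le> 1 - cos (2 * pi * real n * \<delta>)" "1 - cos (2 * pi * real n * \<delta>) \<le> 2"
    using cos_le_one cos_ge_minus_one[of "2 * pi * real n * \<delta>"] by auto
  ultimately have "\<bar>1 - cos (2 * pi * real n * \<delta>)\<bar> \<le> pi\<^sup>2" by linarith
  then have "\<bar>(1 - cos (2 * pi * real n * \<delta>)) / pi\<^sup>2\<bar> \<le> 1" by (simp add: divide_le_eq_1)
  then have "\<bar>(1 - cos (2 * pi * real n * \<delta>)) / pi\<^sup>2\<bar> / (real n)\<^sup>2 \<le> 1 / (real n)\<^sup>2"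
    by (intro divide_right_mono) auto
  then show ?thesis by (simp add: tent_coeff_def abs_mult)
qed (simp add: tent_coeff_def)

lemma tent_sums: "(\<lambda>n. tent_coeff \<delta> n * cos (2 * pi * real n * x)) sums (tent \<delta> x - \<delta>\<^sup>2)"
proof -
  have "\<bar>tent_coeff \<delta> n\<bar> * \<bar>cos (2 * pi * real n * x)\<bar> \<le> 1 / (real n)\<^sup>2 * 1" for n
    by (intro mult_mono abs_tent_coeff_le) auto
  then have "summable (\<lambda>n. tent_coeff \<delta> n * cos (2 * pi * real n * x))"
    by (intro summable_comparison_test'[OF summable_inverse_squares]) (simp add: abs_mult)
  then show ?thesis by (simp add: tent_def summable_sums)
qed

text \<open>
  The points \<open>x - \<delta>\<close>, \<open>x\<close>, \<open>x + \<delta>\<close> lie in one period, where the dilogarithm series is the quadratic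
  \<open>\<pi>\<^sup>2 (x\<^sup>2 - x)\<close> plus a constant. Its second difference is \<open>2 \<pi>\<^sup>2 \<delta>\<^sup>2\<close>, which cancels the mean.
\<close>
lemma tent_eq_0_unit_interval:
  assumes "0 < \<delta>" "\<delta> < x" "x < 1 - \<delta>"
  shows "tent \<delta> x = 0"
proof -
  have Q: "(\<lambda>n. cos (2 * pi * real n * y) / (real n)\<^sup>2) sums dilog_cos 1 y" for y
    using summable_sums[OF dilog_cos_summable[of 1 y]] by (simp add: dilog_cos_def)
  have "(\<lambda>n. (2 * (cos (2 * pi * real n * x) / (real n)\<^sup>2) - cos (2 * pi * real n * (x + \<delta>)) / (real n)\<^sup>2
       - cos (2 * pi * real n * (x - \<delta>)) / (real n)\<^sup>2) / (2 * pi\<^sup>2)) sums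
     ((2 * dilog_cos 1 x - dilog_cos 1 (x + \<delta>) - dilog_cos 1 (x - \<delta>)) / (2 * pi\<^sup>2))"
    by (intro sums_divide sums_diff sums_mult Q)
  moreover have "(2 * (cos (2 * pi * real n * x) / (real n)\<^sup>2) - cos (2 * pi * real n * (x + \<delta>)) / (real n)\<^sup>2
       - cos (2 * pi * real n * (x - \<delta>)) / (real n)\<^sup>2) / (2 * pi\<^sup>2)
     = tent_coeff \<delta> n * cos (2 * pi * real n * x)" for n
    by (cases "n = 0") (simp_all add: tent_coeff_def cos_add cos_diff ring_distribs field_simps)
  ultimately have "tent \<delta> x - \<delta>\<^sup>2 = (2 * dilog_cos 1 x - dilog_cos 1 (x + \<delta>) - dilog_cos 1 (x - \<delta>)) / (2 * pi\<^sup>2)"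
    using tent_sums[of \<delta> x] by (simp add: sums_iff)
  moreover have "dilog_cos 1 (x + \<delta>) = dilog_cos 1 x - pi\<^sup>2 * (x\<^sup>2 - x) + pi\<^sup>2 * ((x + \<delta>)\<^sup>2 - (x + \<delta>))"
    using dilog_cos_1_quadratic[of x "x + \<delta>"] assms by simp
  moreover have "dilog_cos 1 (x - \<delta>) = dilog_cos 1 x - pi\<^sup>2 * (x\<^sup>2 - x) + pi\<^sup>2 * ((x - \<delta>)\<^sup>2 - (x - \<delta>))"
    using dilog_cos_1_quadratic[of x "x - \<delta>"] assms by simp
  ultimately have "tent \<delta> x - \<delta>\<^sup>2 = (2 * pi\<^sup>2 * (x\<^sup>2 - x) - pi\<^sup>2 * ((x + \<delta>)\<^sup>2 - (x + \<delta>))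
       - pi\<^sup>2 * ((x - \<delta>)\<^sup>2 - (x - \<delta>))) / (2 * pi\<^sup>2)"
    by (simp add: algebra_simps)
  also have "\<dots> = - \<delta>\<^sup>2" by (simp add: power2_eq_square field_simps)
  finally show ?thesis by simp
qed

lemma tent_nonzeroD:
  assumes "tent \<delta> x \<noteq> 0" "0 < \<delta>"
  obtains n :: int where "x - \<delta> \<le> of_int n" "of_int n \<le> x + \<delta>"
proof -
  have "cos (2 * pi * real n * frac x) = cos (2 * pi * real n * x)" for n
  proof -
    have "2 * pi * real n * frac x = 2 * pi * real n * x - 2 * pi * of_int (int n * \<lfloor>x\<rfloor>)"
      by (simp add: frac_def algebra_simps)
    also have "cos \<dots> = cos (2 * pi * real n * x)"
      unfolding cos_diff by (simp add: cos_int_2pin sin_int_2pin del: of_int_mult)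
    finally show ?thesis .
  qed
  then have "tent \<delta> (frac x) = tent \<delta> x" by (simp add: tent_def)
  then have "frac x \<le> \<delta> \<or> 1 - \<delta> \<le> frac x"
    using assms tent_eq_0_unit_interval[of \<delta> "frac x"] by force
  then show ?thesis
  proof
    assume "frac x \<le> \<delta>"
    then show ?thesis using assms(2) of_int_floor_le[of x] unfolding frac_def by (intro that[of "\<lfloor>x\<rfloor>"]) linarith+
  next
    assume "1 - \<delta> \<le> frac x"
    then show ?thesis using assms(2) frac_lt_1[of x] unfolding frac_def by (intro that[of "\<lfloor>x\<rfloor> + 1"]) auto
  qed
qed

section \<open>Van der Corput's second-derivative test\<close>

lemma sin_pi_ge:
  assumes "0 \<le> x" "x \<le> 1 / 2"
  shows "2 * x \<le> sin (pi * x)"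
proof -
  have conv: "convex_on {0..1/2} (\<lambda>x. - sin (pi * x))"
  proof (rule f''_ge0_imp_convex)
    show "((\<lambda>x. - sin (pi * x)) has_real_derivative - (pi * cos (pi * x))) (at x)" for x
      by (auto intro!: derivative_eq_intros)
    show "((\<lambda>x. - (pi * cos (pi * x))) has_real_derivative pi * (pi * sin (pi * x))) (at x)" for x
      by (auto intro!: derivative_eq_intros)
    show "0 \<le> pi * (pi * sin (pi * x))" if "x \<in> {0..1/2}" for x :: real
      using that by (intro mult_nonneg_nonneg sin_ge_zero) (auto simp: field_simps)
  qed simp
  from convex_onD[OF conv, of "2 * x" 0 "1/2"] assms show ?thesis by simp
qed

lemma sin_pi_ge_away_from_integers:
  assumes "0 < \<theta>" "\<theta> \<le> x" "x \<le> 1 - \<theta>"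
  shows "2 * \<theta> \<le> sin (pi * x)"
proof (cases "x \<le> 1 / 2")
  case True
  then show ?thesis using assms sin_pi_ge[of x] by simp
next
  case False
  have "sin (pi * x) = sin (pi * (1 - x))" by (simp add: right_diff_distrib)
  then show ?thesis using assms False sin_pi_ge[of "1 - x"] by simp
qed

text \<open>
  The terms \<open>u n = e(f n)\<close> satisfy \<open>u n = v n * (u n - u (n + 1))\<close> with \<open>v n = 1 / (1 - e(g n)) = (1 + i cot (\<pi> g n)) / 2\<close>.
  Summation by parts leaves boundary terms and the total variation of \<open>v\<close>; as \<open>g\<close> is monotone, so is the
  cotangent, and the variation telescopes.
\<close>
lemma Kusmin_Landau_unit_interval:
  fixes f g :: "nat \<Rightarrow> real"
  assumes f: "\<And>n. f (Suc n) = f n + g n" and ab: "a < b" and \<theta>: "0 < \<theta>"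
    and range: "\<And>n. a \<le> n \<Longrightarrow> n < b \<Longrightarrow> \<theta> \<le> g n \<and> g n \<le> 1 - \<theta>"
    and mono: "\<And>n. a \<le> n \<Longrightarrow> Suc n < b \<Longrightarrow> g (Suc n) \<le> g n"
  shows "norm (\<Sum>n\<in>{a..<b}. cis (2 * pi * f n)) \<le> 1 / \<theta>"
proof -
  define u where "u = (\<lambda>n. cis (2 * pi * f n))"
  define t where "t = (\<lambda>n. cos (pi * g n) / (2 * sin (pi * g n)))"
  define v where "v = (\<lambda>n. Complex (1 / 2) (t n))"
  have sin: "2 * \<theta> \<le> sin (pi * g n)" if "a \<le> n" "n < b" for n
    using sin_pi_ge_away_from_integers \<theta> range[OF that] by blast
  have v1: "v n * (1 - cis (2 * pi * g n)) = 1" if "a \<le> n" "n < b" for n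
  proof -
    define S C where "S = sin (pi * g n)" and "C = cos (pi * g n)"
    have S: "S \<noteq> 0" using sin[OF that] \<theta> unfolding S_def by linarith
    have "cos (2 * (pi * g n)) = 1 - 2 * S\<^sup>2" "sin (2 * (pi * g n)) = 2 * S * C"
      unfolding S_def C_def by (rule cos_double_sin, rule sin_double)
    then have cis: "cis (2 * pi * g n) = Complex (1 - 2 * S\<^sup>2) (2 * S * C)"
      by (simp add: complex_eq_iff mult.assoc)
    have "S\<^sup>2 + C\<^sup>2 = 1" by (simp add: S_def C_def)
    then have "v n * (1 - cis (2 * pi * g n)) = of_real (S\<^sup>2 + C\<^sup>2)"
      using S unfolding cis v_def t_def S_def[symmetric] C_def[symmetric]
      by (simp add: complex_eq_iff field_simps power2_eq_square)
    then show ?thesis using \<open>S\<^sup>2 + C\<^sup>2 = 1\<close> by simp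
  qed
  have uu: "u (Suc n) = u n * cis (2 * pi * g n)" for n
    by (simp add: u_def f cis_mult distrib_left)
  have v2: "v n * u (Suc n) = v n * u n - u n" if "a \<le> n" "n < b" for n
  proof -
    have "v n * u (Suc n) = v n * u n - u n * (v n * (1 - cis (2 * pi * g n)))"
      unfolding uu by (simp add: algebra_simps)
    then show ?thesis by (simp only: v1[OF that] mult_1_right)
  qed
  have normv: "norm (v n) \<le> 1 / (4 * \<theta>)" if "a \<le> n" "n < b" for n
  proof -
    have s: "sin (pi * g n) > 0" using sin[OF that] \<theta> by linarith
    have "(norm (v n))\<^sup>2 = (1 / (2 * sin (pi * g n)))\<^sup>2"
      using s sin_cos_squared_add[of "pi * g n"] unfolding v_def t_def
      by (simp add: cmod_power2 divide_simps)
    then have "norm (v n) = 1 / (2 * sin (pi * g n))"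
      using s by (simp add: power2_eq_iff_nonneg)
    also have "\<dots> \<le> 1 / (4 * \<theta>)"
      using s sin[OF that] \<theta> by (intro divide_left_mono) auto
    finally show ?thesis .
  qed
  have tabs: "\<bar>t n\<bar> \<le> 1 / (4 * \<theta>)" if "a \<le> n" "n < b" for n
    using normv[OF that] abs_Im_le_cmod[of "v n"] by (simp add: v_def)
  have tmono: "t n \<le> t (Suc n)" if "a \<le> n" "Suc n < b" for n
  proof -
    have s: "sin (pi * g n) > 0" "sin (pi * g (Suc n)) > 0"
      using sin[of n] sin[of "Suc n"] \<theta> that by linarith+
    have "pi * (g n - g (Suc n)) \<le> pi * 1"
      using range[of n] range[of "Suc n"] that \<theta> by (intro mult_left_mono) auto
    then have "0 \<le> sin (pi * g n - pi * g (Suc n))"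
      using mono[OF that] by (intro sin_ge_zero) (auto simp: right_diff_distrib)
    then have "cos (pi * g n) * sin (pi * g (Suc n)) \<le> cos (pi * g (Suc n)) * sin (pi * g n)"
      by (simp add: sin_diff mult_ac)
    then show ?thesis using s by (simp add: t_def field_simps)
  qed
  have key: "norm ((\<Sum>n\<in>{a..m}. u n) - v a * u a + v m * u (Suc m)) \<le> t m - t a"
    if "a \<le> m" "m < b" for m
    using that
  proof (induction m rule: dec_induct)
    case base
    then show ?case using v2[of a] by simp
  next
    case (step m)
    have "(\<Sum>n\<in>{a..Suc m}. u n) - v a * u a + v (Suc m) * u (Suc (Suc m))
      = ((\<Sum>n\<in>{a..m}. u n) - v a * u a + v m * u (Suc m)) + (v (Suc m) - v m) * u (Suc m)"
      using step v2[of "Suc m"] by (simp add: algebra_simps)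
    moreover have "norm ((v (Suc m) - v m) * u (Suc m)) = t (Suc m) - t m"
    proof -
      have "v (Suc m) - v m = \<i> * of_real (t (Suc m) - t m)" by (simp add: v_def complex_eq_iff)
      then show ?thesis using tmono[of m] step by (simp add: norm_mult u_def del: of_real_diff)
    qed
    moreover have "norm ((\<Sum>n\<in>{a..m}. u n) - v a * u a + v m * u (Suc m)) \<le> t m - t a"
      using step by simp
    ultimately show ?case by (smt (verit) norm_triangle_ineq)
  qed
  define m where "m = b - 1"
  have m: "a \<le> m" "m < b" "{a..<b} = {a..m}" using ab by (auto simp: m_def)
  have "norm (\<Sum>n\<in>{a..m}. u n) \<le> norm ((\<Sum>n\<in>{a..m}. u n) - v a * u a + v m * u (Suc m))
      + norm (v a * u a) + norm (v m * u (Suc m))"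
    using norm_triangle_ineq4[of "((\<Sum>n\<in>{a..m}. u n) - v a * u a + v m * u (Suc m)) + v a * u a" "v m * u (Suc m)"]
      norm_triangle_ineq[of "(\<Sum>n\<in>{a..m}. u n) - v a * u a + v m * u (Suc m)" "v a * u a"]
    by (simp add: algebra_simps)
  also have "\<dots> \<le> (t m - t a) + 1 / (4 * \<theta>) + 1 / (4 * \<theta>)"
    using key[OF m(1,2)] normv[of a] normv[OF m(1,2)] ab by (simp add: norm_mult u_def)
  also have "\<dots> \<le> 4 * (1 / (4 * \<theta>))"
    using tabs[of a] tabs[OF m(1,2)] ab by linarith
  finally show ?thesis by (simp add: m(3) u_def)
qed

text \<open>An integer \<open>j\<close> can be removed from all increments without changing any \<open>e(f n)\<close>.\<close>
lemma Kusmin_Landau: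
  fixes f g :: "nat \<Rightarrow> real" and j :: int
  assumes f: "\<And>n. f (Suc n) = f n + g n" and \<theta>: "0 < \<theta>"
    and range: "\<And>n. a \<le> n \<Longrightarrow> n < b \<Longrightarrow> of_int j + \<theta> \<le> g n \<and> g n \<le> of_int j + 1 - \<theta>"
    and mono: "\<And>n. a \<le> n \<Longrightarrow> Suc n < b \<Longrightarrow> g (Suc n) \<le> g n"
  shows "norm (\<Sum>n\<in>{a..<b}. cis (2 * pi * f n)) \<le> 1 / \<theta>"
proof (cases "a < b")
  case True
  define f' where "f' = (\<lambda>n. f n - of_int j * real n)"
  have "cis (2 * pi * f' n) = cis (2 * pi * f n)" for n
  proof -
    have "2 * pi * f' n = 2 * pi * f n - 2 * pi * of_int (j * int n)"
      by (simp add: f'_def algebra_simps)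
    then show ?thesis by (simp flip: cis_divide del: of_int_mult)
  qed
  moreover have "norm (\<Sum>n\<in>{a..<b}. cis (2 * pi * f' n)) \<le> 1 / \<theta>"
  proof (rule Kusmin_Landau_unit_interval[of f' "\<lambda>n. g n - of_int j"])
    show "f' (Suc n) = f' n + (g n - of_int j)" for n by (simp add: f'_def f algebra_simps)
  qed (use True \<theta> range mono in \<open>auto simp: algebra_simps\<close>)
  ultimately show ?thesis by simp
qed (use \<theta> in simp)

lemma steep_sequence_decrease:
  fixes g :: "nat \<Rightarrow> real"
  assumes "\<And>n. a \<le> n \<Longrightarrow> n < b \<Longrightarrow> \<mu> \<le> g n - g (Suc n)" "a \<le> m" "m \<le> n" "n \<le> b"
  shows "\<mu> * real (n - m) \<le> g m - g n"
  using assms(3,4)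
proof (induction n rule: dec_induct)
  case (step n)
  have "\<mu> \<le> g n - g (Suc n)" using assms(1)[of n] assms(2) step by auto
  then show ?case using step by (simp add: Suc_diff_le ring_distribs)
qed simp

lemma card_steep_sequence_in_interval:
  fixes g :: "nat \<Rightarrow> real"
  assumes g: "\<And>n. a \<le> n \<Longrightarrow> n < b \<Longrightarrow> \<mu> \<le> g n - g (Suc n)" and \<mu>: "0 < \<mu>" and "0 \<le> \<theta>"
    and X: "X \<subseteq> {a..<b}" "\<And>n. n \<in> X \<Longrightarrow> y \<le> g n \<and> g n \<le> y + \<theta>"
  shows "real (card X) \<le> \<theta> / \<mu> + 1"
proof (cases "X = {}")
  case False
  have fin: "finite X" using X(1) finite_subset by blast
  define p q where "p = Min X" and "q = Max X"
  have pq: "p \<in> X" "q \<in> X" "X \<subseteq> {p..q}" using fin False by (auto simp: p_def q_def)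
  have "\<mu> * real (q - p) \<le> g p - g q"
    using pq X(1) by (intro steep_sequence_decrease[where a = a and b = b]) (auto intro: g)
  also have "\<dots> \<le> \<theta>" using X(2)[OF pq(1)] X(2)[OF pq(2)] by linarith
  finally have "real (q - p) \<le> \<theta> / \<mu>" using \<mu> by (simp add: field_simps)
  moreover have "card X \<le> Suc q - p" using card_mono[OF _ pq(3)] by simp
  then have "card X \<le> (q - p) + 1" by linarith
  then have "real (card X) \<le> real (q - p) + 1" by linarith
  ultimately show ?thesis by linarith
qed (use assms in simp)

text \<open>
  Group the indices by \<open>\<lfloor>g n\<rfloor>\<close>; there are at most \<open>V + 2\<close> groups. Within a group, the increments at distance at
  least \<open>\<theta>\<close> from the integers form an interval of indices, to which the Kusmin--Landau inequality applies and gives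
  \<open>1 / \<theta>\<close>; the remaining indices number at most \<open>2 (\<theta> / \<mu> + 1)\<close>, because \<open>g\<close> drops by \<open>\<mu>\<close> at each step. The
  choice \<open>\<theta> = sqrt \<mu>\<close> balances the two.
\<close>
lemma van_der_Corput_second_difference:
  fixes f g :: "nat \<Rightarrow> real"
  assumes f: "\<And>n. f (Suc n) = f n + g n" and ab: "a \<le> b"
    and g: "\<And>n. a \<le> n \<Longrightarrow> n < b \<Longrightarrow> \<mu> \<le> g n - g (Suc n)" and \<mu>: "0 < \<mu>" "\<mu> \<le> 1 / 4"
    and V: "g a - g b \<le> V"
  shows "norm (\<Sum>n\<in>{a..<b}. cis (2 * pi * f n)) \<le> (V + 2) * (4 / sqrt \<mu>)"
proof -
  define \<theta> where "\<theta> = sqrt \<mu>"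
  have \<theta>: "0 < \<theta>" "\<theta> \<le> 1 / 2" "\<theta> / \<mu> = 1 / \<theta>"
    using \<mu> real_sqrt_le_mono[of \<mu> "1/4"] real_sqrt_divide[of 1 4]
    by (auto simp: \<theta>_def real_div_sqrt field_simps)
  define u where "u = (\<lambda>n. cis (2 * pi * f n))"
  have anti: "g n \<le> g m" if "a \<le> m" "m \<le> n" "n \<le> b" for m n
  proof -
    have "0 \<le> \<mu> * real (n - m)" using \<mu> by simp
    then show ?thesis using steep_sequence_decrease[of a b \<mu> g, OF g that] by simp
  qed
  define B where "B = (\<lambda>j::int. {n\<in>{a..<b}. \<lfloor>g n\<rfloor> = j})"
  define J where "J = (\<lambda>n. \<lfloor>g n\<rfloor>) ` {a..<b}"
  have block: "norm (\<Sum>n\<in>B j. u n) \<le> 4 / \<theta>" for j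
  proof -
    define Y where "Y = {n\<in>{a..<b}. of_int j + \<theta> \<le> g n \<and> g n \<le> of_int j + 1 - \<theta>}"
    define X1 where "X1 = {n\<in>{a..<b}. of_int j \<le> g n \<and> g n \<le> of_int j + \<theta>}"
    define X2 where "X2 = {n\<in>{a..<b}. of_int j + 1 - \<theta> \<le> g n \<and> g n \<le> (of_int j + 1 - \<theta>) + \<theta>}"
    have YB: "Y \<subseteq> B j" "finite (B j)" using \<theta> by (auto simp: Y_def B_def floor_eq_iff)
    have BX: "B j - Y \<subseteq> X1 \<union> X2" unfolding B_def Y_def X1_def X2_def by (auto simp: floor_eq_iff)
    have fin: "finite X1" "finite X2" by (auto simp: X1_def X2_def)
    have c1: "real (card X1) \<le> \<theta> / \<mu> + 1"
      by (rule card_steep_sequence_in_interval[of a b \<mu> g, OF g \<mu>(1), where y = "of_int j"])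
         (use \<theta>(1) in \<open>auto simp: X1_def\<close>)
    have c2: "real (card X2) \<le> \<theta> / \<mu> + 1"
      by (rule card_steep_sequence_in_interval[of a b \<mu> g, OF g \<mu>(1), where y = "of_int j + 1 - \<theta>"])
         (use \<theta>(1) in \<open>auto simp: X2_def\<close>)
    have "norm (\<Sum>n\<in>B j - Y. u n) \<le> real (card (B j - Y))"
      by (rule order_trans[OF sum_norm_le[of _ _ "\<lambda>_. 1"]]) (auto simp: u_def)
    also have "card (B j - Y) \<le> card X1 + card X2"
      by (rule order_trans[OF card_mono[OF _ BX] card_Un_le]) (use fin in simp)
    then have "real (card (B j - Y)) \<le> real (card X1) + real (card X2)" by linarith
    also have "\<dots> \<le> 2 * (1 / \<theta> + 1)" using c1 c2 \<theta>(3) by simp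
    finally have near: "norm (\<Sum>n\<in>B j - Y. u n) \<le> 2 * (1 / \<theta> + 1)" .
    have far: "norm (\<Sum>n\<in>Y. u n) \<le> 1 / \<theta>"
    proof (cases "Y = {}")
      case False
      define p q where "p = Min Y" and "q = Max Y"
      have "finite Y" by (simp add: Y_def)
      then have pq: "p \<in> Y" "q \<in> Y" "Y \<subseteq> {p..q}" using False by (auto simp: p_def q_def)
      have inY: "n \<in> Y" if "p \<le> n" "n \<le> q" for n
        using pq(1,2) that anti[of p n] anti[of n q] unfolding Y_def by auto
      have "Y = {p..<Suc q}" using pq(3) inY by auto
      moreover have "norm (\<Sum>n\<in>{p..<Suc q}. u n) \<le> 1 / \<theta>"
        unfolding u_def
      proof (rule Kusmin_Landau[where f = f and g = g, OF f \<theta>(1)])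
        show "of_int j + \<theta> \<le> g n \<and> g n \<le> of_int j + 1 - \<theta>" if "p \<le> n" "n < Suc q" for n
          using inY[of n] that by (auto simp: Y_def)
        show "g (Suc n) \<le> g n" if "p \<le> n" "Suc n < Suc q" for n
          using that pq(1,2) by (intro anti) (auto simp: Y_def)
      qed
      ultimately show ?thesis by simp
    qed (use \<theta> in simp)
    have "(\<Sum>n\<in>B j. u n) = (\<Sum>n\<in>B j - Y. u n) + (\<Sum>n\<in>Y. u n)"
      by (rule sum.subset_diff[OF YB])
    then have "norm (\<Sum>n\<in>B j. u n) \<le> 2 * (1 / \<theta> + 1) + 1 / \<theta>"
      using norm_triangle_le[OF add_mono[OF near far]] by (simp only:)
    also have "\<dots> \<le> 4 / \<theta>" using \<theta> by (simp add: field_simps)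
    finally show ?thesis .
  qed
  have cJ: "real (card J) \<le> V + 2"
  proof -
    have "J \<subseteq> {\<lfloor>g b\<rfloor>..\<lfloor>g a\<rfloor>}" unfolding J_def by (auto intro!: floor_mono anti)
    then have "card J \<le> nat (\<lfloor>g a\<rfloor> + 1 - \<lfloor>g b\<rfloor>)"
      using card_mono[of "{\<lfloor>g b\<rfloor>..\<lfloor>g a\<rfloor>}" J] by simp
    moreover have "\<lfloor>g b\<rfloor> \<le> \<lfloor>g a\<rfloor>" using ab by (intro floor_mono anti) auto
    ultimately have "real (card J) \<le> of_int (\<lfloor>g a\<rfloor> + 1 - \<lfloor>g b\<rfloor>)" by linarith
    also have "\<dots> \<le> V + 2" using V of_int_floor_le[of "g a"] real_of_int_floor_add_one_gt[of "g b"]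
      unfolding of_int_diff of_int_add of_int_1 by linarith
    finally show ?thesis .
  qed
  have "(\<Sum>n\<in>{a..<b}. u n) = (\<Sum>j\<in>J. \<Sum>n\<in>B j. u n)"
    unfolding J_def B_def by (rule sum.image_gen) simp
  then have "norm (\<Sum>n\<in>{a..<b}. u n) \<le> (\<Sum>j\<in>J. 4 / \<theta>)"
    by (simp only:) (rule sum_norm_le[OF block])
  also have "\<dots> = real (card J) * (4 / \<theta>)" by simp
  also have "\<dots> \<le> (V + 2) * (4 / \<theta>)" using cJ \<theta> by (intro mult_right_mono) auto
  finally show ?thesis by (simp add: u_def \<theta>_def)
qed

section \<open>Cosine polynomials with sparse frequencies\<close>

lemma Fejer_kernel_sum_of_squares:
  fixes t :: real
  shows "real N + 2 * (\<Sum>r<N. \<Sum>m\<in>{1..r}. cos (real m * t))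
    = (\<Sum>j<N. cos (real j * t))\<^sup>2 + (\<Sum>j<N. sin (real j * t))\<^sup>2"
proof (induction N)
  case (Suc N)
  \<comment> \<open>Reversing the order of summation turns the new terms into the cross terms of the squares.\<close>
  have "(\<Sum>m\<in>{1..N}. cos (real m * t)) = (\<Sum>j<N. cos (real (N - j) * t))"
    by (rule sum.reindex_bij_witness[of _ "\<lambda>j. N - j" "\<lambda>m. N - m"]) auto
  also have "\<dots> = (\<Sum>j<N. cos (real N * t) * cos (real j * t) + sin (real N * t) * sin (real j * t))"
    by (intro sum.cong refl) (simp add: of_nat_diff left_diff_distrib cos_diff)
  also have "\<dots> = cos (real N * t) * (\<Sum>j<N. cos (real j * t)) + sin (real N * t) * (\<Sum>j<N. sin (real j * t))"
    by (simp add: sum.distrib sum_distrib_left)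
  finally have dir: "(\<Sum>m\<in>{1..N}. cos (real m * t)) = \<dots>" .
  have "(cos (real N * t))\<^sup>2 + (sin (real N * t))\<^sup>2 = 1" by simp
  with Suc show ?case
    unfolding sum.lessThan_Suc dir by (simp add: power2_eq_square algebra_simps)
qed simp

lemma Fejer_kernel_ge: "- (real N / 2) \<le> (\<Sum>r<N. \<Sum>m\<in>{1..r}. cos (2 * pi * real m * \<xi>))"
proof -
  have "0 \<le> real N + 2 * (\<Sum>r<N. \<Sum>m\<in>{1..r}. cos (real m * (2 * pi * \<xi>)))"
    unfolding Fejer_kernel_sum_of_squares by simp
  then show ?thesis by (simp add: mult_ac)
qed

text \<open>
  Fejer weights are averages of sharp cut-offs, so bounds for unweighted partial sums transfer to weighted sums
  without summation by parts.
\<close>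
lemma weighted_partial_sums:
  fixes x :: "nat \<Rightarrow> real"
  shows "(\<Sum>r<N. \<Sum>m\<in>{m\<^sub>0..r}. x m) = (\<Sum>m\<in>{m\<^sub>0..<N}. (real N - real m) * x m)"
proof (induction N)
  case (Suc N)
  have "(\<Sum>m\<in>{m\<^sub>0..<Suc N}. (real (Suc N) - real m) * x m)
      = (\<Sum>m\<in>{m\<^sub>0..<Suc N}. (real N - real m) * x m) + (\<Sum>m\<in>{m\<^sub>0..<Suc N}. x m)"
    by (simp add: sum.distrib[symmetric] algebra_simps)
  also have "(\<Sum>m\<in>{m\<^sub>0..<Suc N}. (real N - real m) * x m) = (\<Sum>m\<in>{m\<^sub>0..<N}. (real N - real m) * x m)"
    by (rule sum.mono_neutral_right) (auto simp: not_less less_Suc_eq)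
  finally show ?case using Suc by (simp add: atLeastLessThanSuc_atLeastAtMost)
qed simp

text \<open>
  The bound is uniform in \<open>\<xi>\<close> and holds for all \<open>k\<close>: if \<open>k \<Lambda>\<close> exceeds \<open>1 / 4\<close>, the test does not apply, but then
  \<open>sqrt (k / \<Lambda>)\<close> exceeds \<open>1 / (2 \<Lambda>)\<close>, hence \<open>N / 2\<close>, and the number of terms is a sufficient bound.
\<close>
lemma concave_phase_exponential_sum:
  fixes P :: "nat \<Rightarrow> real"
  assumes conc: "\<And>m. m\<^sub>0 \<le> m \<Longrightarrow> m < N \<Longrightarrow> \<Lambda> \<le> (P (Suc m) - P m) - (P (Suc (Suc m)) - P (Suc m))"
    and incr: "\<And>m. m\<^sub>0 \<le> m \<Longrightarrow> m \<le> N \<Longrightarrow> P m \<le> P (Suc m)"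
    and V: "P (Suc m\<^sub>0) - P m\<^sub>0 \<le> V" "0 \<le> V" and \<Lambda>: "0 < \<Lambda>" "\<Lambda> * real N \<le> 1"
    and r: "r < N" and k: "1 \<le> k"
  shows "\<bar>\<Sum>m\<in>{m\<^sub>0..r}. cos (2 * pi * (real k * P m + \<xi> * real m + c))\<bar> \<le> 4 * (V + 2) * sqrt (real k / \<Lambda>)"
proof (cases "m\<^sub>0 \<le> Suc r")
  case True
  define f where "f = (\<lambda>m. real k * P m + \<xi> * real m + c)"
  define g where "g = (\<lambda>m. real k * (P (Suc m) - P m) + \<xi>)"
  have Re: "(\<Sum>m\<in>{m\<^sub>0..r}. cos (2 * pi * f m)) = Re (\<Sum>m\<in>{m\<^sub>0..<Suc r}. cis (2 * pi * f m))"
    by (simp add: atLeastLessThanSuc_atLeastAtMost)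
  have "norm (\<Sum>m\<in>{m\<^sub>0..<Suc r}. cis (2 * pi * f m)) \<le> 4 * (V + 2) * sqrt (real k / \<Lambda>)"
  proof (cases "real k * \<Lambda> \<le> 1 / 4")
    case small: True
    have "norm (\<Sum>m\<in>{m\<^sub>0..<Suc r}. cis (2 * pi * f m)) \<le> (real k * V + 2) * (4 / sqrt (real k * \<Lambda>))"
    proof (rule van_der_Corput_second_difference[of f g])
      show "f (Suc n) = f n + g n" for n by (simp add: f_def g_def algebra_simps)
      show "real k * \<Lambda> \<le> g n - g (Suc n)" if "m\<^sub>0 \<le> n" "n < Suc r" for n
        using mult_left_mono[OF conc[of n], of "real k"] that r by (simp add: g_def algebra_simps)
      have "real k * (P (Suc m\<^sub>0) - P m\<^sub>0) \<le> real k * V" using V by (intro mult_left_mono) auto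
      moreover have "0 \<le> real k * (P (Suc (Suc r)) - P (Suc r))"
        using incr[of "Suc r"] True r by (intro mult_nonneg_nonneg) auto
      ultimately show "g m\<^sub>0 - g (Suc r) \<le> real k * V" unfolding g_def by linarith
    qed (use True small k \<Lambda> in auto)
    also have "\<dots> \<le> (real k * (V + 2)) * (4 / sqrt (real k * \<Lambda>))"
      using k \<Lambda> by (intro mult_right_mono) (auto simp: distrib_left)
    also have "\<dots> = 4 * (V + 2) * (real k / sqrt (real k * \<Lambda>))" by simp
    also have "real k / sqrt (real k * \<Lambda>) = sqrt (real k / \<Lambda>)"
      using k \<Lambda> by (simp add: real_sqrt_mult real_sqrt_divide real_div_sqrt flip: divide_divide_eq_left)
    finally show ?thesis .
  next
    case False
    have "norm (\<Sum>m\<in>{m\<^sub>0..<Suc r}. cis (2 * pi * f m)) \<le> real (card {m\<^sub>0..<Suc r})"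
      by (rule order_trans[OF sum_norm_le[of _ _ "\<lambda>_. 1"]]) auto
    also have "\<dots> \<le> real N" using r by auto
    also have "\<dots> \<le> 1 / \<Lambda>" using \<Lambda> by (simp add: field_simps)
    also have "\<dots> \<le> 2 * sqrt (real k / \<Lambda>)"
    proof -
      have "(1 / (2 * \<Lambda>))\<^sup>2 = (1 / 4) / \<Lambda> / \<Lambda>" by (simp add: power2_eq_square)
      also have "\<dots> \<le> (real k * \<Lambda>) / \<Lambda> / \<Lambda>" using False \<Lambda> by (intro divide_right_mono) auto
      also have "\<dots> = real k / \<Lambda>" using \<Lambda> by simp
      finally have "1 / (2 * \<Lambda>) \<le> sqrt (real k / \<Lambda>)" by (rule real_le_rsqrt)
      then show ?thesis by (simp add: field_simps)
    qed
    also have "\<dots> \<le> 4 * (V + 2) * sqrt (real k / \<Lambda>)"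
      using V \<Lambda> by (intro mult_right_mono) auto
    finally show ?thesis .
  qed
  then have "\<bar>Re (\<Sum>m\<in>{m\<^sub>0..<Suc r}. cis (2 * pi * f m))\<bar> \<le> 4 * (V + 2) * sqrt (real k / \<Lambda>)"
    using abs_Re_le_cmod order_trans by blast
  then show ?thesis unfolding Re[symmetric] by (simp only: f_def)
next
  case False
  then show ?thesis using V \<Lambda> by simp
qed

definition zeta_three_halves :: real where "zeta_three_halves = (\<Sum>k. sqrt (real k) / (real k)\<^sup>2)"

lemma summable_sqrt_over_square: "summable (\<lambda>k. sqrt (real k) / (real k)\<^sup>2)"
proof -
  have "sqrt (real k) / (real k)\<^sup>2 = real k powr (- 3 / 2)" for k
  proof (cases "k = 0")
    case False
    then have "sqrt (real k) / (real k)\<^sup>2 = real k powr (1 / 2) / real k powr 2"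
      by (simp add: powr_half_sqrt powr_numeral)
    also have "\<dots> = real k powr (1 / 2 - 2)" by (rule powr_diff[symmetric])
    finally show ?thesis by simp
  qed simp
  then show ?thesis by (simp add: summable_real_powr_iff)
qed

lemma zeta_three_halves_nonneg: "0 \<le> zeta_three_halves"
  unfolding zeta_three_halves_def by (intro suminf_nonneg summable_sqrt_over_square) simp

text \<open>
  Insert the Fourier series of the tent. Its mean gives the second sum on the left; the \<open>k\<close>-th term carries
  a coefficient at most \<open>1 / k\<^sup>2\<close> and an exponential sum of size \<open>sqrt (k / \<Lambda>)\<close>.
\<close>
lemma tent_weighted_cos_sum:
  fixes P :: "nat \<Rightarrow> real"
  assumes conc: "\<And>m. m\<^sub>0 \<le> m \<Longrightarrow> m < N \<Longrightarrow> \<Lambda> \<le> (P (Suc m) - P m) - (P (Suc (Suc m)) - P (Suc m))"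
    and incr: "\<And>m. m\<^sub>0 \<le> m \<Longrightarrow> m \<le> N \<Longrightarrow> P m \<le> P (Suc m)"
    and V: "P (Suc m\<^sub>0) - P m\<^sub>0 \<le> V" "0 \<le> V" and \<Lambda>: "0 < \<Lambda>" "\<Lambda> * real N \<le> 1"
    and r: "r < N"
  shows "\<bar>(\<Sum>m\<in>{m\<^sub>0..r}. tent \<delta> (P m + c) * cos (2 * pi * real m * \<xi>))
      - \<delta>\<^sup>2 * (\<Sum>m\<in>{m\<^sub>0..r}. cos (2 * pi * real m * \<xi>))\<bar> \<le> 4 * (V + 2) * zeta_three_halves / sqrt \<Lambda>"
proof -
  define B where "B = 4 * (V + 2) / sqrt \<Lambda>"
  define U where "U = (\<lambda>k. \<Sum>m\<in>{m\<^sub>0..r}. cos (2 * pi * real k * (P m + c)) * cos (2 * pi * real m * \<xi>))"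
  have U: "\<bar>U k\<bar> \<le> B * sqrt (real k)" if "1 \<le> k" for k
  proof -
    have "cos (2 * pi * real k * (P m + c)) * cos (2 * pi * real m * \<xi>)
      = cos (2 * pi * (real k * P m + (- \<xi>) * real m + real k * c)) / 2
        + cos (2 * pi * (real k * P m + \<xi> * real m + real k * c)) / 2" for m
    proof -
      define x y where "x = 2 * pi * real k * (P m + c)" and "y = 2 * pi * real m * \<xi>"
      have "2 * pi * (real k * P m + (- \<xi>) * real m + real k * c) = x - y"
        "2 * pi * (real k * P m + \<xi> * real m + real k * c) = x + y"
        by (simp_all add: x_def y_def algebra_simps)
      then show ?thesis
        unfolding x_def[symmetric] y_def[symmetric] by (simp only: cos_times_cos add_divide_distrib)
    qed
    then have "U k = (\<Sum>m\<in>{m\<^sub>0..r}. cos (2 * pi * (real k * P m + (- \<xi>) * real m + real k * c))) / 2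
        + (\<Sum>m\<in>{m\<^sub>0..r}. cos (2 * pi * (real k * P m + \<xi> * real m + real k * c))) / 2"
      unfolding U_def by (simp only: sum.distrib sum_divide_distrib[symmetric])
    moreover have "\<bar>\<Sum>m\<in>{m\<^sub>0..r}. cos (2 * pi * (real k * P m + \<eta> * real m + real k * c))\<bar>
        \<le> 4 * (V + 2) * sqrt (real k / \<Lambda>)" for \<eta>
      by (rule concave_phase_exponential_sum[OF conc incr V \<Lambda> r that])
    from this[of "- \<xi>"] this[of \<xi>] have "\<bar>X / 2 + Y / 2\<bar> \<le> 4 * (V + 2) * sqrt (real k / \<Lambda>)"
      if "X = (\<Sum>m\<in>{m\<^sub>0..r}. cos (2 * pi * (real k * P m + (- \<xi>) * real m + real k * c)))"
        "Y = (\<Sum>m\<in>{m\<^sub>0..r}. cos (2 * pi * (real k * P m + \<xi> * real m + real k * c)))" for X Y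
      unfolding that by linarith
    ultimately have "\<bar>U k\<bar> \<le> 4 * (V + 2) * sqrt (real k / \<Lambda>)" by simp
    then show ?thesis by (simp add: B_def real_sqrt_divide)
  qed
  have "(\<lambda>k. \<Sum>m\<in>{m\<^sub>0..r}. tent_coeff \<delta> k * cos (2 * pi * real k * (P m + c)) * cos (2 * pi * real m * \<xi>))
     sums (\<Sum>m\<in>{m\<^sub>0..r}. (tent \<delta> (P m + c) - \<delta>\<^sup>2) * cos (2 * pi * real m * \<xi>))"
    by (intro sums_sum sums_mult2 tent_sums)
  then have sums: "(\<lambda>k. tent_coeff \<delta> k * U k)
     sums (\<Sum>m\<in>{m\<^sub>0..r}. (tent \<delta> (P m + c) - \<delta>\<^sup>2) * cos (2 * pi * real m * \<xi>))"
    by (simp add: U_def sum_distrib_left mult.assoc)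
  have bound: "norm (tent_coeff \<delta> k * U k) \<le> B * (sqrt (real k) / (real k)\<^sup>2)" for k
  proof (cases "k = 0")
    case False
    then have "\<bar>tent_coeff \<delta> k\<bar> * \<bar>U k\<bar> \<le> 1 / (real k)\<^sup>2 * (B * sqrt (real k))"
      by (intro mult_mono abs_tent_coeff_le U) auto
    then show ?thesis by (simp add: abs_mult)
  qed (simp add: tent_coeff_def)
  have "norm (\<Sum>k. tent_coeff \<delta> k * U k) \<le> (\<Sum>k. B * (sqrt (real k) / (real k)\<^sup>2))"
    by (intro norm_suminf_le summable_mult summable_sqrt_over_square bound)
  also have "\<dots> = B * zeta_three_halves"
    unfolding zeta_three_halves_def by (rule suminf_mult[OF summable_sqrt_over_square])
  finally show ?thesis
    using sums by (simp add: sums_iff B_def left_diff_distrib sum_subtractf sum_distrib_left)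
qed

lemma truncated_sum_diff:
  fixes x :: "nat \<Rightarrow> real"
  assumes "\<And>m. \<bar>x m\<bar> \<le> 1" "1 \<le> m\<^sub>0"
  shows "(\<Sum>m\<in>{1..r}. x m) - real m\<^sub>0 \<le> (\<Sum>m\<in>{m\<^sub>0..r}. x m)"
proof -
  have "(\<Sum>m\<in>{1..r}. x m) = (\<Sum>m\<in>{1..r} - {m\<^sub>0..r}. x m) + (\<Sum>m\<in>{m\<^sub>0..r}. x m)"
    by (rule sum.subset_diff) (use assms(2) in auto)
  moreover have "(\<Sum>m\<in>{1..r} - {m\<^sub>0..r}. x m) \<le> (\<Sum>m\<in>{1..r} - {m\<^sub>0..r}. 1)"
    using assms(1) by (intro sum_mono) (metis abs_le_D1)
  moreover have "(\<Sum>m\<in>{1..r} - {m\<^sub>0..r}. 1 :: real) \<le> real m\<^sub>0"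
  proof -
    have "card ({1..r} - {m\<^sub>0..r}) \<le> card {..<m\<^sub>0}" by (intro card_mono) auto
    then show ?thesis by simp
  qed
  ultimately show ?thesis by linarith
qed

text \<open>
  The sequence \<open>P\<close> stands for the inverse of \<open>h\<close>. The shift by \<open>2 \<delta>\<close> puts the support \<open>[P m + \<delta>, P m + 3 \<delta>]\<close> of the
  weights inside the open interval from \<open>P m\<close> to \<open>P (m + 1)\<close>, so that floors and ceilings can be treated alike.
\<close>
theorem cos_gamma_le_of_concave_inverse:
  fixes P :: "nat \<Rightarrow> real"
  assumes N: "1 \<le> N" and m0: "1 \<le> m\<^sub>0" and \<delta>: "0 < \<delta>"
    and conc: "\<And>m. m\<^sub>0 \<le> m \<Longrightarrow> m < N \<Longrightarrow> \<Lambda> \<le> (P (Suc m) - P m) - (P (Suc (Suc m)) - P (Suc m))"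
    and gap: "\<And>m. m\<^sub>0 \<le> m \<Longrightarrow> m \<le> N \<Longrightarrow> 4 * \<delta> \<le> P (Suc m) - P m"
    and V: "P (Suc m\<^sub>0) - P m\<^sub>0 \<le> V" "0 \<le> V" and \<Lambda>: "0 < \<Lambda>" "\<Lambda> * real N \<le> 1"
    and S: "\<And>m (n::int). m\<^sub>0 \<le> m \<Longrightarrow> P m < of_int n \<Longrightarrow> of_int n < P (Suc m) \<Longrightarrow> int m \<in> S"
  shows "cos_gamma S N \<le> 2 * (real m\<^sub>0 + 1) / real N + 8 * (V + 2) * zeta_three_halves / (\<delta>\<^sup>2 * sqrt \<Lambda> * real N)"
proof -
  \<comment> \<open>\<open>N E\<close> is what must be added to \<open>R\<close> to make it nonnegative: \<open>\<delta>\<^sup>2 m\<^sub>0\<close> pays for the frequencies below \<open>m\<^sub>0\<close>,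
      \<open>\<delta>\<^sup>2\<close> for the negative part of the Fejer kernel, and the last term for the exponential sums.\<close>
  define E where "E = \<delta>\<^sup>2 * (real m\<^sub>0 + 1) + 4 * (V + 2) * zeta_three_halves / sqrt \<Lambda>"
  define w where "w = (\<lambda>m. tent \<delta> (P m + 2 * \<delta>))"
  define R where "R = (\<lambda>\<xi>. \<Sum>r<N. \<Sum>m\<in>{m\<^sub>0..r}. w m * cos (2 * pi * real m * \<xi>))"
  define Z where "Z = real N * E + R 0"
  define a where "a = (\<lambda>s::int. if s = 0 then real N * E / Z
      else if int m\<^sub>0 \<le> s \<and> s < int N then (real N - of_int s) * w (nat s) / Z else 0)"
  have incr: "P m \<le> P (Suc m)" if "m\<^sub>0 \<le> m" "m \<le> N" for m using gap[OF that] \<delta> by linarith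
  have wS: "int m \<in> S" if "w m \<noteq> 0" "m\<^sub>0 \<le> m" "m < N" for m
  proof -
    obtain n :: int where n: "P m + 2 * \<delta> - \<delta> \<le> of_int n" "of_int n \<le> P m + 2 * \<delta> + \<delta>"
      using tent_nonzeroD[of \<delta> "P m + 2 * \<delta>"] \<open>w m \<noteq> 0\<close> \<delta> unfolding w_def by blast
    then show ?thesis using gap[of m] that \<delta> by (intro S[of m n]) auto
  qed
  have R_ge: "\<delta>\<^sup>2 * ((\<Sum>r<N. \<Sum>m\<in>{1..r}. cos (2 * pi * real m * \<xi>)) - real N * real m\<^sub>0)
      - real N * (4 * (V + 2) * zeta_three_halves / sqrt \<Lambda>) \<le> R \<xi>" for \<xi>
  proof -
    have "\<delta>\<^sup>2 * ((\<Sum>m\<in>{1..r}. cos (2 * pi * real m * \<xi>)) - real m\<^sub>0) - 4 * (V + 2) * zeta_three_halves / sqrt \<Lambda>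
       \<le> (\<Sum>m\<in>{m\<^sub>0..r}. w m * cos (2 * pi * real m * \<xi>))" if r: "r < N" for r
    proof -
      have "\<delta>\<^sup>2 * ((\<Sum>m\<in>{1..r}. cos (2 * pi * real m * \<xi>)) - real m\<^sub>0)
          \<le> \<delta>\<^sup>2 * (\<Sum>m\<in>{m\<^sub>0..r}. cos (2 * pi * real m * \<xi>))"
        by (intro mult_left_mono truncated_sum_diff m0) auto
      then show ?thesis
        using tent_weighted_cos_sum[OF conc incr V \<Lambda> r, of \<delta> "2 * \<delta>" \<xi>] unfolding w_def by linarith
    qed
    then have "(\<Sum>r<N. \<delta>\<^sup>2 * ((\<Sum>m\<in>{1..r}. cos (2 * pi * real m * \<xi>)) - real m\<^sub>0) - 4 * (V + 2) * zeta_three_halves / sqrt \<Lambda>)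
      \<le> R \<xi>" unfolding R_def by (intro sum_mono) auto
    then show ?thesis by (simp add: sum_subtractf flip: sum_distrib_left)
  qed
  have NE: "real N * E = \<delta>\<^sup>2 * real N * real m\<^sub>0 + \<delta>\<^sup>2 * real N
        + real N * (4 * (V + 2) * zeta_three_halves / sqrt \<Lambda>)"
    by (simp add: E_def algebra_simps)
  have R_lower: "0 \<le> real N * E + R \<xi>" for \<xi>
  proof -
    have "\<delta>\<^sup>2 * (- (real N / 2)) \<le> \<delta>\<^sup>2 * (\<Sum>r<N. \<Sum>m\<in>{1..r}. cos (2 * pi * real m * \<xi>))"
      by (intro mult_left_mono Fejer_kernel_ge) auto
    moreover have "0 \<le> \<delta>\<^sup>2 * real N" by simp
    ultimately show ?thesis using R_ge[of \<xi>] NE unfolding right_diff_distrib mult.assoc[symmetric] by linarith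
  qed
  have triangle: "(\<Sum>r<N. \<Sum>m\<in>{1..r}. cos (2 * pi * real m * 0)) = (real N)\<^sup>2 / 2 - real N / 2"
    by (simp add: sum.nat_group) (induction N, simp_all add: power2_eq_square field_simps)
  have \<delta>N: "0 \<le> \<delta>\<^sup>2 * real N" by simp
  from R_ge[of 0, unfolded triangle] have Z_ge: "\<delta>\<^sup>2 * (real N)\<^sup>2 / 2 \<le> Z"
    using \<delta>N NE unfolding Z_def right_diff_distrib mult.assoc[symmetric] times_divide_eq_right by linarith
  have "0 < \<delta>\<^sup>2 * (real N)\<^sup>2 / 2" using \<delta> N by simp
  with Z_ge have Z: "0 < Z" by linarith
  have poly: "cos_poly (S \<inter> {1..int N}) a \<xi> = (real N * E + R \<xi>) / Z" for \<xi>
  proof -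
    have "R \<xi> / Z = (\<Sum>m\<in>{m\<^sub>0..<N}. (real N - real m) * w m / Z * cos (2 * pi * real m * \<xi>))"
      unfolding R_def weighted_partial_sums by (simp add: sum_divide_distrib mult_ac)
    also have "\<dots> = (\<Sum>m\<in>{m\<^sub>0..<N}. a (int m) * cos (2 * pi * real m * \<xi>))"
      using m0 by (intro sum.cong refl) (auto simp: a_def)
    also have "\<dots> = (\<Sum>s\<in>int ` {m\<^sub>0..<N}. a s * cos (2 * pi * of_int s * \<xi>))"
      by (simp add: sum.reindex)
    also have "\<dots> = (\<Sum>s\<in>S \<inter> {1..int N}. a s * cos (2 * pi * of_int s * \<xi>))"
    proof (rule sum.mono_neutral_cong)
      show "a s * cos (2 * pi * of_int s * \<xi>) = 0" if "s \<in> (S \<inter> {1..int N}) - int ` {m\<^sub>0..<N}" for s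
      proof -
        have "s \<notin> int ` {m\<^sub>0..<N}" "1 \<le> s" using that by auto
        moreover have "s \<in> int ` {m\<^sub>0..<N}" if "int m\<^sub>0 \<le> s" "s < int N"
          using that by (intro image_eqI[of _ _ "nat s"]) auto
        ultimately have "\<not> (int m\<^sub>0 \<le> s \<and> s < int N)" by blast
        then have "a s = 0" using \<open>1 \<le> s\<close> unfolding a_def by auto
        then show ?thesis by simp
      qed
      show "a s * cos (2 * pi * of_int s * \<xi>) = 0" if sD: "s \<in> int ` {m\<^sub>0..<N} - (S \<inter> {1..int N})" for s
      proof -
        have nS: "s \<notin> S \<inter> {1..int N}" using sD by blast
        have "s \<in> int ` {m\<^sub>0..<N}" using sD by blast
        then obtain m where m: "s = int m" "m\<^sub>0 \<le> m" "m < N" by auto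
        then have "int m \<notin> S" using m0 nS by auto
        then have "w m = 0" using wS m by blast
        then show ?thesis using m m0 by (simp add: a_def)
      qed
    qed auto
    finally show ?thesis by (simp add: cos_poly_def a_def add_divide_distrib)
  qed
  have "a \<in> nonneg_cos_polys (S \<inter> {1..int N})"
    using R_lower Z unfolding nonneg_cos_polys_def mem_Collect_eq poly by (simp add: Z_def[symmetric])
  then have "cos_gamma S N \<le> real N * E / Z"
    using cos_gamma_le[OF _ N, of a S] by (simp add: a_def)
  also have "\<dots> \<le> real N * E / (\<delta>\<^sup>2 * (real N)\<^sup>2 / 2)"
  proof (intro divide_left_mono Z_ge mult_nonneg_nonneg)
    show "0 \<le> E" using V \<Lambda> zeta_three_halves_nonneg by (simp add: E_def)
  qed (use \<delta> N Z in auto)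
  also have "\<dots> = 2 * (real m\<^sub>0 + 1) / real N + 8 * (V + 2) * zeta_three_halves / (\<delta>\<^sup>2 * sqrt \<Lambda> * real N)"
    using \<delta> N \<Lambda> unfolding E_def by (simp add: field_simps power2_eq_square)
  finally show ?thesis .
qed

section \<open>Growth in Hardy fields\<close>

text \<open>
  Working with representatives instead of germs turns the field operations into pointwise ones.
\<close>
definition in_germ_field :: "(real \<Rightarrow> real) set set \<Rightarrow> (real \<Rightarrow> real) \<Rightarrow> bool" where
  "in_germ_field K f \<longleftrightarrow> f \<in> ev_smooth \<and> germ f \<in> K"

context
  fixes K assumes K: "hardy_field K"
begin

lemma germ_field_subfield: "subfield K germ_ring" "subring K germ_ring"
  using K subfieldE(1) unfolding hardy_field_def by auto

lemma germ_field_add: "in_germ_field K f \<Longrightarrow> in_germ_field K g \<Longrightarrow> in_germ_field K (\<lambda>t. f t + g t)"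
  using subringE(7)[OF germ_field_subfield(2), of "germ f" "germ g"]
  by (simp add: in_germ_field_def germ_add ev_smooth_binop)

lemma germ_field_mult: "in_germ_field K f \<Longrightarrow> in_germ_field K g \<Longrightarrow> in_germ_field K (\<lambda>t. f t * g t)"
  using subringE(6)[OF germ_field_subfield(2), of "germ f" "germ g"]
  by (simp add: in_germ_field_def germ_mult ev_smooth_binop)

lemma germ_field_deriv: "in_germ_field K f \<Longrightarrow> in_germ_field K (deriv f)"
  using K by (auto simp: hardy_field_def in_germ_field_def ev_smooth_deriv germ_deriv_germ[symmetric])

lemma germ_field_0: "in_germ_field K (\<lambda>t. 0)"
  using subringE(2)[OF germ_field_subfield(2)] by (simp add: in_germ_field_def germ_ring_zero ev_smooth_const)

lemma germ_field_1: "in_germ_field K (\<lambda>t. 1)"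
  using subringE(3)[OF germ_field_subfield(2)] by (simp add: in_germ_field_def germ_ring_one ev_smooth_const)

lemma germ_field_cases:
  assumes "X \<in> K" obtains f where "in_germ_field K f" "X = germ f"
  using assms subringE(1)[OF germ_field_subfield(2)] carrier_cases unfolding in_germ_field_def
  by (metis subsetD)

lemma germ_field_cong:
  assumes "in_germ_field K f" "g \<in> ev_smooth" "eventually (\<lambda>t. f t = g t) at_top"
  shows "in_germ_field K g"
  using assms germ_eq_iff[of f g] by (simp add: in_germ_field_def)

lemma germ_field_minus:
  assumes f: "in_germ_field K f"
  shows "in_germ_field K (\<lambda>t. - f t)"
proof -
  interpret cring germ_ring by (rule cring_germ_ring)
  have "\<ominus>\<^bsub>germ_ring\<^esub> germ f \<in> K"
    using subringE(5)[OF germ_field_subfield(2)] f by (simp add: in_germ_field_def)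
  then obtain g where g: "in_germ_field K g" "\<ominus>\<^bsub>germ_ring\<^esub> germ f = germ g"
    by (rule germ_field_cases)
  have "germ f \<oplus>\<^bsub>germ_ring\<^esub> germ g = \<zero>\<^bsub>germ_ring\<^esub>"
    using f r_neg[OF germ_in_carrier, of f] by (simp add: g(2)[symmetric] in_germ_field_def)
  then have "eventually (\<lambda>t. f t + g t = 0) at_top"
    using f g(1) by (simp add: in_germ_field_def germ_add germ_ring_zero germ_eq_iff ev_smooth_binop ev_smooth_const)
  then have "eventually (\<lambda>t. g t = - f t) at_top" by eventually_elim simp
  moreover have "(\<lambda>t. - f t) \<in> ev_smooth"
    using ev_smooth_binop(2)[OF ev_smooth_const[of "-1"], of f] f by (simp add: in_germ_field_def)
  ultimately show ?thesis using germ_field_cong[OF g(1)] by blast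
qed

lemma germ_field_inverse:
  assumes f: "in_germ_field K f" and nz: "\<not> eventually (\<lambda>t. f t = 0) at_top"
  obtains g where "in_germ_field K g" "eventually (\<lambda>t. f t * g t = 1) at_top"
proof -
  interpret cring germ_ring by (rule cring_germ_ring)
  have "germ f \<in> K - {\<zero>\<^bsub>germ_ring\<^esub>}"
    using f nz by (simp add: in_germ_field_def germ_ring_zero germ_eq_iff ev_smooth_const)
  note inv = subfield_m_inv[OF germ_field_subfield(1) this]
  then obtain g where g: "in_germ_field K g" "inv\<^bsub>germ_ring\<^esub> germ f = germ g"
    using germ_field_cases by (metis DiffD1)
  have "germ f \<otimes>\<^bsub>germ_ring\<^esub> germ g = \<one>\<^bsub>germ_ring\<^esub>"
    using inv(2) by (simp add: g(2))
  then have "eventually (\<lambda>t. f t * g t = 1) at_top"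
    using f g(1) by (simp add: in_germ_field_def germ_mult germ_ring_one germ_eq_iff ev_smooth_binop ev_smooth_const)
  then show ?thesis using that g(1) by blast
qed

lemma germ_field_of_nat: "in_germ_field K (\<lambda>t. real n)"
proof (induction n)
  case (Suc n)
  then show ?case using germ_field_add[OF germ_field_1, of "\<lambda>t. real n"] by simp
qed (simp add: germ_field_0)

lemma germ_field_of_rat:
  assumes "q \<in> \<rat>" "0 \<le> q"
  shows "in_germ_field K (\<lambda>t. q)"
proof -
  obtain m n where mn: "n \<noteq> 0" "\<bar>q\<bar> = real m / real n"
    using Rats_abs_nat_div_natE[OF assms(1)] by metis
  have "\<not> eventually (\<lambda>t::real. real n = 0) at_top" using mn(1) by simp
  then obtain g where g: "in_germ_field K g" "eventually (\<lambda>t. real n * g t = 1) at_top"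
    using germ_field_inverse[OF germ_field_of_nat] by blast
  have "in_germ_field K (\<lambda>t. real m * g t)" by (rule germ_field_mult[OF germ_field_of_nat g(1)])
  moreover have "eventually (\<lambda>t. real m * g t = q) at_top"
    using g(2)
  proof eventually_elim
    case (elim t)
    have "real m * g t = q * (real n * g t)" using mn assms(2) by simp
    then show ?case using elim by simp
  qed
  ultimately show ?thesis by (rule germ_field_cong[OF _ ev_smooth_const])
qed

end

lemma ev_smooth_DERIV:
  assumes "f \<in> ev_smooth"
  shows "eventually (\<lambda>t. (f has_real_derivative deriv f t) (at t)) at_top"
proof -
  obtain u where "smooth_on {u<..} f" using assms by (auto simp: ev_smooth_def)
  then have "\<forall>t>u. ((deriv ^^ 0) f) differentiable (at t)" unfolding smooth_on_def by blast
  then show ?thesis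
    unfolding eventually_at_top_dense by (auto simp: DERIV_deriv_iff_real_differentiable)
qed

text \<open>
  A function whose germ is nonzero has an inverse germ, so it has no large zeros; by continuity its sign is
  eventually constant.
\<close>
lemma germ_field_trichotomy:
  assumes K: "hardy_field K" and f: "in_germ_field K f"
  shows "eventually (\<lambda>t. f t = 0) at_top \<or> eventually (\<lambda>t. f t > 0) at_top \<or> eventually (\<lambda>t. f t < 0) at_top"
proof (cases "eventually (\<lambda>t. f t = 0) at_top")
  case False
  obtain g where g: "eventually (\<lambda>t. f t * g t = 1) at_top"
    using germ_field_inverse[OF K f False] .
  have "eventually (\<lambda>t. (f has_real_derivative deriv f t) (at t)) at_top"
    using f ev_smooth_DERIV by (simp add: in_germ_field_def)
  with g have "eventually (\<lambda>t. f t \<noteq> 0 \<and> isCont f t) at_top"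
    by eventually_elim (auto intro: DERIV_isCont)
  then obtain T where T: "\<And>t. t \<ge> T \<Longrightarrow> f t \<noteq> 0 \<and> isCont f t"
    by (auto simp: eventually_at_top_linorder)
  have no_change: "\<not> (f s < 0 \<and> 0 < f t)" if "T \<le> s" "T \<le> t" for s t
  proof
    assume "f s < 0 \<and> 0 < f t"
    then have "\<exists>x\<ge>min s t. x \<le> max s t \<and> f x = 0"
    proof (cases "s \<le> t")
      case True
      have "\<exists>x\<ge>s. x \<le> t \<and> f x = 0"
        by (rule IVT) (use True T that \<open>f s < 0 \<and> 0 < f t\<close> in auto)
      then show ?thesis using True by simp
    next
      case False
      have "\<exists>x\<ge>t. x \<le> s \<and> f x = 0"
        by (rule IVT2) (use False T that \<open>f s < 0 \<and> 0 < f t\<close> in auto)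
      then show ?thesis using False by simp
    qed
    then obtain x where "min s t \<le> x" "f x = 0" by blast
    moreover from this have "T \<le> x" using that by linarith
    ultimately show False using T by blast
  qed
  show ?thesis
  proof (cases "f T > 0")
    case True
    then have "\<forall>t\<ge>T. f t > 0" using no_change T by (metis linorder_neqE_linordered_idom order_refl)
    then show ?thesis by (auto simp: eventually_at_top_linorder)
  next
    case False
    then have "\<forall>t\<ge>T. f t < 0" using no_change T by (metis linorder_neqE_linordered_idom order_refl)
    then show ?thesis by (auto simp: eventually_at_top_linorder)
  qed
qed simp

lemma powr_eventually_dominates:
  assumes "\<alpha> < \<beta>"
  shows "eventually (\<lambda>t::real. C * t powr \<alpha> < t powr \<beta>) at_top"
proof -
  define d where "d = \<beta> - \<alpha>"
  have d: "0 < d" using assms by (simp add: d_def)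
  have "eventually (\<lambda>t. C < t powr d) at_top"
    using eventually_ge_at_top[of "(\<bar>C\<bar> + 1) powr (1 / d)"]
  proof eventually_elim
    case (elim t)
    have "((\<bar>C\<bar> + 1) powr (1 / d)) powr d \<le> t powr d"
      using elim d by (intro powr_mono2) auto
    then show ?case using d by (simp add: powr_powr)
  qed
  with eventually_gt_at_top[of 0] show ?thesis
  proof eventually_elim
    case (elim t)
    then have "C * t powr \<alpha> < t powr d * t powr \<alpha>" by (intro mult_strict_right_mono) auto
    then show ?case by (simp add: powr_add[symmetric] d_def)
  qed
qed

lemma growth_rate_le:
  assumes "eventually (\<lambda>t. \<bar>h t\<bar> \<le> C * t powr \<beta>) at_top"
  shows "growth_rate h \<le> ereal \<beta>"
proof (rule ereal_le_real)
  fix z assume "ereal \<beta> \<le> ereal z"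
  show "growth_rate h \<le> ereal z"
  proof (rule dense_ge)
    fix y assume y: "ereal z < y"
    show "growth_rate h \<le> y"
    proof (cases y)
      case (real \<alpha>)
      have "eventually (\<lambda>t. C * t powr \<beta> < t powr \<alpha>) at_top"
        using y \<open>ereal \<beta> \<le> ereal z\<close> real by (intro powr_eventually_dominates) auto
      with assms have "eventually (\<lambda>t. \<bar>h t\<bar> \<le> t powr \<alpha>) at_top" by eventually_elim linarith
      then show ?thesis unfolding growth_rate_def real by (intro INF_lower) simp
    qed (use y in auto)
  qed
qed

lemma growth_rate_less_D:
  assumes "growth_rate h < ereal \<alpha>"
  shows "eventually (\<lambda>t. \<bar>h t\<bar> \<le> t powr \<alpha>) at_top"
proof -
  obtain \<alpha>' where ev: "eventually (\<lambda>t. \<bar>h t\<bar> \<le> t powr \<alpha>') at_top" and less: "\<alpha>' < \<alpha>"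
    using assms unfolding growth_rate_def INF_less_iff by auto
  from ev eventually_ge_at_top[of 1] show ?thesis
  proof eventually_elim
    case (elim t)
    have "t powr \<alpha>' \<le> t powr \<alpha>" using elim less by (intro powr_mono) auto
    then show ?case using elim by linarith
  qed
qed

lemma growth_rate_minus: "growth_rate (\<lambda>t. - h t) = growth_rate h"
  by (simp add: growth_rate_def)

text \<open>
  Both parts say that \<open>H t * t powr (- p)\<close> is monotone, its derivative having the sign of \<open>t H' - p H\<close>.
\<close>
lemma power_bound_of_log_derivative:
  fixes H H' :: "real \<Rightarrow> real"
  assumes T: "0 < T" and der: "\<And>t. T \<le> t \<Longrightarrow> (H has_real_derivative H' t) (at t)"
  shows "(\<And>t. T \<le> t \<Longrightarrow> p * H t \<le> t * H' t) \<Longrightarrow> T \<le> t \<Longrightarrow> H T * T powr (- p) * t powr p \<le> H t"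
    and "(\<And>t. T \<le> t \<Longrightarrow> t * H' t \<le> p * H t) \<Longrightarrow> T \<le> t \<Longrightarrow> H t \<le> H T * T powr (- p) * t powr p"
proof -
  have d: "((\<lambda>t. H t * t powr (- p)) has_real_derivative (t * H' t - p * H t) * t powr (- p - 1)) (at t)"
    if "T \<le> t" for t
  proof -
    have "t powr (- p) = t powr (- p - 1 + 1)" by simp
    also have "\<dots> = t * t powr (- p - 1)" unfolding powr_add using T that by simp
    finally have eq: "t powr (- p) = t * t powr (- p - 1)" .
    have "((\<lambda>t. H t * t powr (- p)) has_real_derivative
        H' t * t powr (- p) + (- p) * t powr (- p - 1) * H t) (at t)"
      using T that by (intro DERIV_mult der has_real_derivative_powr) auto
    then show ?thesis unfolding eq by (simp add: algebra_simps)
  qed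
  have cancel: "H t * t powr (- p) * t powr p = H t" if "T \<le> t" for t
    using T that by (simp add: mult.assoc powr_add[symmetric])
  show "H T * T powr (- p) * t powr p \<le> H t" if "\<And>t. T \<le> t \<Longrightarrow> p * H t \<le> t * H' t" "T \<le> t"
  proof -
    have "H T * T powr (- p) \<le> H t * t powr (- p)"
      by (rule DERIV_nonneg_imp_nondecreasing[OF that(2)]) (use d that(1) in fastforce)
    then have "H T * T powr (- p) * t powr p \<le> H t * t powr (- p) * t powr p"
      by (intro mult_right_mono) auto
    then show ?thesis using cancel[OF that(2)] by simp
  qed
  show "H t \<le> H T * T powr (- p) * t powr p" if "\<And>t. T \<le> t \<Longrightarrow> t * H' t \<le> p * H t" "T \<le> t"
  proof -
    have "H t * t powr (- p) \<le> H T * T powr (- p)"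
      by (rule DERIV_nonpos_imp_nonincreasing[OF that(2)])
         (use d that(1) in \<open>fastforce intro: mult_nonpos_nonneg\<close>)
    then have "H t * t powr (- p) * t powr p \<le> H T * T powr (- p) * t powr p"
      by (intro mult_right_mono) auto
    then show ?thesis using cancel[OF that(2)] by simp
  qed
qed

text \<open>Integrate the derivative \<open>(H'\<^sup>2 - H H'') / H'\<^sup>2\<close> of \<open>H / H'\<close>.\<close>
lemma log_derivative_ratio:
  fixes H H' H'' :: "real \<Rightarrow> real"
  assumes H: "\<And>t. T \<le> t \<Longrightarrow> (H has_real_derivative H' t) (at t)"
      "\<And>t. T \<le> t \<Longrightarrow> (H' has_real_derivative H'' t) (at t)" "\<And>t. T \<le> t \<Longrightarrow> 0 < H' t"
  shows "(\<And>t. T \<le> t \<Longrightarrow> (H' t)\<^sup>2 - H t * H'' t \<le> q * (H' t)\<^sup>2) \<Longrightarrow> T \<le> t \<Longrightarrow> H t / H' t \<le> H T / H' T + q * (t - T)"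
    and "(\<And>t. T \<le> t \<Longrightarrow> q * (H' t)\<^sup>2 \<le> (H' t)\<^sup>2 - H t * H'' t) \<Longrightarrow> T \<le> t \<Longrightarrow> H T / H' T + q * (t - T) \<le> H t / H' t"
proof -
  have d: "((\<lambda>t. H t / H' t - q * t) has_real_derivative ((H' t)\<^sup>2 - H t * H'' t) / (H' t)\<^sup>2 - q) (at t)"
    if "T \<le> t" for t
  proof -
    have "((\<lambda>t. H t / H' t - q * t) has_real_derivative (H' t * H' t - H t * H'' t) / (H' t * H' t) - q * 1) (at t)"
      using H(3)[OF that] by (intro DERIV_diff DERIV_divide H that DERIV_cmult DERIV_ident) auto
    then show ?thesis by (simp add: power2_eq_square)
  qed
  show "H t / H' t \<le> H T / H' T + q * (t - T)"
    if "\<And>t. T \<le> t \<Longrightarrow> (H' t)\<^sup>2 - H t * H'' t \<le> q * (H' t)\<^sup>2" "T \<le> t"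
  proof -
    have "((H' t)\<^sup>2 - H t * H'' t) / (H' t)\<^sup>2 - q \<le> 0" if "T \<le> t" for t
      using H(3)[OF that] \<open>\<And>t. T \<le> t \<Longrightarrow> (H' t)\<^sup>2 - H t * H'' t \<le> q * (H' t)\<^sup>2\<close>[OF that]
      by (simp add: divide_le_eq)
    then have "H t / H' t - q * t \<le> H T / H' T - q * T"
      by (intro DERIV_nonpos_imp_nonincreasing[OF that(2)]) (use d in blast)
    then show ?thesis by (simp add: algebra_simps)
  qed
  show "H T / H' T + q * (t - T) \<le> H t / H' t"
    if "\<And>t. T \<le> t \<Longrightarrow> q * (H' t)\<^sup>2 \<le> (H' t)\<^sup>2 - H t * H'' t" "T \<le> t"
  proof -
    have "0 \<le> ((H' t)\<^sup>2 - H t * H'' t) / (H' t)\<^sup>2 - q" if "T \<le> t" for t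
      using H(3)[OF that] \<open>\<And>t. T \<le> t \<Longrightarrow> q * (H' t)\<^sup>2 \<le> (H' t)\<^sup>2 - H t * H'' t\<close>[OF that]
      by (simp add: le_divide_eq)
    then have "H T / H' T - q * T \<le> H t / H' t - q * t"
      by (intro DERIV_nonneg_imp_nondecreasing[OF that(2)]) (use d in blast)
    then show ?thesis by (simp add: algebra_simps)
  qed
qed

text \<open>
  If \<open>(H / H')' \<le> q\<close>, then \<open>H / H' \<le> q' t\<close> eventually for every \<open>q' > q\<close>, that is \<open>H' / H \<ge> 1 / (q' t)\<close>, and
  \<open>H\<close> is at least a constant times \<open>t powr (1 / q')\<close>.
\<close>
lemma growth_rate_ge_of_ratio:
  fixes H H' H'' :: "real \<Rightarrow> real"
  assumes q: "0 < q" and ev: "eventually (\<lambda>t. (H has_real_derivative H' t) (at t) \<and>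
      (H' has_real_derivative H'' t) (at t) \<and> 0 < H t \<and> 0 < H' t \<and> (H' t)\<^sup>2 - H t * H'' t \<le> q * (H' t)\<^sup>2) at_top"
  shows "ereal (1 / q) \<le> growth_rate H"
proof (rule ccontr)
  assume "\<not> ?thesis"
  then have "growth_rate H < ereal (1 / q)" by simp
  then obtain \<alpha> where \<alpha>: "growth_rate H < ereal \<alpha>" "\<alpha> < 1 / q" by (metis ereal_dense2 less_ereal.simps(1))
  define r where "r = 1 / q"
  define p where "p = (max \<alpha> 0 + r) / 2"
  have "0 < r" "\<alpha> < r" using q \<alpha>(2) by (simp_all add: r_def)
  then have "0 < p" "\<alpha> < p" "p < r" unfolding p_def by (auto simp: max_def)
  then have p: "0 < p" "\<alpha> < p" "p < 1 / q" by (simp_all add: r_def)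
  \<comment> \<open>From \<open>T1\<close> on, the slack \<open>(q' - q) t\<close> absorbs the constant of integration.\<close>
  define q' where "q' = 1 / p"
  have q': "q < q'" using p q by (simp add: q'_def field_simps)
  obtain T where T: "\<And>t. T \<le> t \<Longrightarrow> (H has_real_derivative H' t) (at t)"
    "\<And>t. T \<le> t \<Longrightarrow> (H' has_real_derivative H'' t) (at t)" "\<And>t. T \<le> t \<Longrightarrow> 0 < H t" "\<And>t. T \<le> t \<Longrightarrow> 0 < H' t"
    "\<And>t. T \<le> t \<Longrightarrow> (H' t)\<^sup>2 - H t * H'' t \<le> q * (H' t)\<^sup>2"
    using ev by (auto simp: eventually_at_top_linorder)
  define T1 where "T1 = max (max T 1) ((H T / H' T - q * T) / (q' - q))"
  have T1: "T \<le> T1" "1 \<le> T1" by (auto simp: T1_def)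
  have pH: "p * H t \<le> t * H' t" if "T1 \<le> t" for t
  proof -
    have t: "T \<le> t" using T1 that by simp
    have "H t / H' t \<le> H T / H' T + q * (t - T)" by (rule log_derivative_ratio(1)[OF T(1,2,4,5) t])
    also have "\<dots> \<le> q' * t"
    proof -
      have "(H T / H' T - q * T) / (q' - q) \<le> t" using that by (simp add: T1_def)
      then show ?thesis using q' by (simp add: divide_le_eq algebra_simps)
    qed
    finally show ?thesis using T(4)[OF t] p by (simp add: q'_def field_simps)
  qed
  have low: "H T1 * T1 powr (- p) * t powr p \<le> H t" if "T1 \<le> t" for t
    by (rule power_bound_of_log_derivative(1)[where H' = H', OF _ T(1) pH that]) (use T1 in auto)
  define C where "C = H T1 * T1 powr (- p)"
  have C: "C > 0" using T(3)[of T1] T1 by (simp add: C_def)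
  have "eventually (\<lambda>t. \<bar>H t\<bar> \<le> t powr \<alpha>) at_top" by (rule growth_rate_less_D[OF \<alpha>(1)])
  moreover have "eventually (\<lambda>t. (1 / C) * t powr \<alpha> < t powr p) at_top"
    by (rule powr_eventually_dominates[OF p(2)])
  ultimately have "eventually (\<lambda>t::real. t \<noteq> t) at_top"
    using eventually_ge_at_top[of T1]
  proof eventually_elim
    case (elim t)
    have "C * t powr p \<le> H t" using low[OF elim(3)] by (simp add: C_def)
    moreover have "t powr \<alpha> < C * t powr p" using elim(2) C by (simp add: field_simps)
    ultimately show ?case using elim(1) by linarith
  qed
  then show False by simp
qed

text \<open>The same argument with all inequalities reversed.\<close>
lemma growth_rate_le_of_ratio:
  fixes H H' H'' :: "real \<Rightarrow> real"
  assumes q: "0 < q" and ev: "eventually (\<lambda>t. (H has_real_derivative H' t) (at t) \<and>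
      (H' has_real_derivative H'' t) (at t) \<and> 0 < H t \<and> 0 < H' t \<and> q * (H' t)\<^sup>2 \<le> (H' t)\<^sup>2 - H t * H'' t) at_top"
  shows "growth_rate H \<le> ereal (1 / q)"
proof (rule dense_ge)
  fix y assume y: "ereal (1 / q) < y"
  obtain T where T: "\<And>t. T \<le> t \<Longrightarrow> (H has_real_derivative H' t) (at t)"
    "\<And>t. T \<le> t \<Longrightarrow> (H' has_real_derivative H'' t) (at t)" "\<And>t. T \<le> t \<Longrightarrow> 0 < H t" "\<And>t. T \<le> t \<Longrightarrow> 0 < H' t"
    "\<And>t. T \<le> t \<Longrightarrow> q * (H' t)\<^sup>2 \<le> (H' t)\<^sup>2 - H t * H'' t"
    using ev by (auto simp: eventually_at_top_linorder)
  show "growth_rate H \<le> y"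
  proof (cases y)
    case (real p)
    then have "1 / q < p" using y by simp
    moreover have "0 < 1 / q" using q by simp
    ultimately have p: "0 < p" "1 / q < p" by linarith+
    define q' where "q' = 1 / p"
    have q': "q' < q" using p q by (simp add: q'_def field_simps)
    define T1 where "T1 = max (max T 1) ((q * T - H T / H' T) / (q - q'))"
    have T1: "T \<le> T1" "1 \<le> T1" by (auto simp: T1_def)
    have pH: "t * H' t \<le> p * H t" if "T1 \<le> t" for t
    proof -
      have t: "T \<le> t" using T1 that by simp
      have "(q * T - H T / H' T) / (q - q') \<le> t" using that by (simp add: T1_def)
      then have "q' * t \<le> H T / H' T + q * (t - T)" using q' by (simp add: divide_le_eq algebra_simps)
      also have "\<dots> \<le> H t / H' t" by (rule log_derivative_ratio(2)[OF T(1,2,4,5) t])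
      finally show ?thesis using T(4)[OF t] p by (simp add: q'_def field_simps)
    qed
    have up: "H t \<le> H T1 * T1 powr (- p) * t powr p" if "T1 \<le> t" for t
      by (rule power_bound_of_log_derivative(2)[where H' = H', OF _ T(1) pH that]) (use T1 in auto)
    have "eventually (\<lambda>t. \<bar>H t\<bar> \<le> H T1 * T1 powr (- p) * t powr p) at_top"
      using eventually_ge_at_top[of T1]
    proof eventually_elim
      case (elim t)
      then show ?case using up[OF elim] T(3)[of t] T1 by simp
    qed
    then show ?thesis unfolding real by (rule growth_rate_le)
  qed (use y in auto)
qed

text \<open>
  The rational bounds \<open>q\<^sub>1 < 1 / c < q\<^sub>2\<close> can be compared with \<open>(H / H')'\<close> inside the Hardy field, which contains the
  rational constants but perhaps neither the other constants nor the identity function. The wrong outcome of a comparison would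
  force a wrong growth rate.
\<close>
lemma hardy_field_regular_growth:
  assumes K: "hardy_field K" and h: "in_germ_field K h" and c: "growth_rate h = ereal c" "0 < c"
    and q: "q\<^sub>1 \<in> \<rat>" "q\<^sub>2 \<in> \<rat>" "0 < q\<^sub>1" "q\<^sub>1 < 1 / c" "1 / c < q\<^sub>2"
  obtains H H' H'' :: "real \<Rightarrow> real" where "H = h \<or> H = (\<lambda>t. - h t)"
    "eventually (\<lambda>t. (H has_real_derivative H' t) (at t) \<and> (H' has_real_derivative H'' t) (at t) \<and>
       0 < H t \<and> 0 < H' t \<and> (1 - q\<^sub>2) * (H' t)\<^sup>2 \<le> H t * H'' t \<and> H t * H'' t \<le> (1 - q\<^sub>1) * (H' t)\<^sup>2) at_top"
proof -
  note closed = germ_field_add[OF K] germ_field_mult[OF K] germ_field_minus[OF K] germ_field_deriv[OF K]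
  have "\<exists>H. (H = h \<or> H = (\<lambda>t. - h t)) \<and> eventually (\<lambda>t. H t > 0) at_top"
    using germ_field_trichotomy[OF K h]
  proof (elim disjE)
    assume "eventually (\<lambda>t. h t = 0) at_top"
    then have "eventually (\<lambda>t. \<bar>h t\<bar> \<le> 0 * t powr 0) at_top" by eventually_elim simp
    from growth_rate_le[OF this] show ?thesis using c by simp
  next
    assume "eventually (\<lambda>t. h t < 0) at_top"
    then show ?thesis by (intro exI[of _ "\<lambda>t. - h t"]) simp
  qed blast
  then obtain H where H: "H = h \<or> H = (\<lambda>t. - h t)" and pos: "eventually (\<lambda>t. H t > 0) at_top" by blast
  have HK: "in_germ_field K H" using H h closed by blast
  have cH: "growth_rate H = ereal c" using H c growth_rate_minus[of h] by auto
  define H' where "H' = deriv H"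
  define H'' where "H'' = deriv H'"
  have HK': "in_germ_field K H'" "in_germ_field K H''" by (auto simp: H'_def H''_def intro: closed HK)
  have d: "eventually (\<lambda>t. (H has_real_derivative H' t) (at t)) at_top"
    "eventually (\<lambda>t. (H' has_real_derivative H'' t) (at t)) at_top"
    using ev_smooth_DERIV HK HK'(1) by (simp_all add: in_germ_field_def H'_def H''_def)
  have pos': "eventually (\<lambda>t. H' t > 0) at_top"
  proof (rule ccontr)
    assume "\<not> ?thesis"
    then have "eventually (\<lambda>t. H' t = 0) at_top \<or> eventually (\<lambda>t. H' t < 0) at_top"
      using germ_field_trichotomy[OF K HK'(1)] by blast
    then have "eventually (\<lambda>t. H' t \<le> 0) at_top"
      by (elim disjE) (auto elim: eventually_mono)
    with d(1) pos have "eventually (\<lambda>t. (H has_real_derivative H' t) (at t) \<and> H t > 0 \<and> H' t \<le> 0) at_top"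
      by eventually_elim simp
    then obtain T where T: "\<And>t. T \<le> t \<Longrightarrow> (H has_real_derivative H' t) (at t)" "\<And>t. T \<le> t \<Longrightarrow> H t > 0"
      "\<And>t. T \<le> t \<Longrightarrow> H' t \<le> 0" by (auto simp: eventually_at_top_linorder)
    have mono: "H t \<le> H T" if "T \<le> t" for t
      by (rule DERIV_nonpos_imp_nonincreasing[OF that]) (use T in blast)
    have "eventually (\<lambda>t. \<bar>H t\<bar> \<le> H T * t powr 0) at_top"
      using eventually_ge_at_top[of T] eventually_gt_at_top[of 0]
    proof eventually_elim
      case (elim t)
      then show ?case using mono[of t] T(2)[of t] by simp
    qed
    from growth_rate_le[OF this] show False using cH c by simp
  qed
  have base: "eventually (\<lambda>t. (H has_real_derivative H' t) (at t) \<and> (H' has_real_derivative H'' t) (at t) \<and>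
       0 < H t \<and> 0 < H' t) at_top"
    using d pos pos' by eventually_elim simp
  have compare: "eventually (\<lambda>t. (H' t)\<^sup>2 - H t * H'' t \<le> q * (H' t)\<^sup>2) at_top \<or>
      eventually (\<lambda>t. q * (H' t)\<^sup>2 \<le> (H' t)\<^sup>2 - H t * H'' t) at_top" if "q \<in> \<rat>" "0 < q" for q
  proof -
    \<comment> \<open>\<open>H'\<^sup>2 - H H'' - q H'\<^sup>2\<close>, written with the operations under which the field is closed\<close>
    define f where "f = (\<lambda>t. H' t * H' t + - (H t * H'' t + q * (H' t * H' t)))"
    have "in_germ_field K f"
      unfolding f_def using that by (intro closed HK HK' germ_field_of_rat[OF K]) auto
    from germ_field_trichotomy[OF K this] have "eventually (\<lambda>t. f t \<le> 0) at_top \<or> eventually (\<lambda>t. 0 \<le> f t) at_top"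
    proof (elim disjE)
      assume "eventually (\<lambda>t. 0 < f t) at_top"
      then have "eventually (\<lambda>t. 0 \<le> f t) at_top" by eventually_elim simp
      then show ?thesis ..
    qed (auto elim: eventually_mono)
    moreover have "f t \<le> 0 \<longleftrightarrow> (H' t)\<^sup>2 - H t * H'' t \<le> q * (H' t)\<^sup>2"
      "0 \<le> f t \<longleftrightarrow> q * (H' t)\<^sup>2 \<le> (H' t)\<^sup>2 - H t * H'' t" for t
      unfolding f_def power2_eq_square by linarith+
    ultimately show ?thesis by simp
  qed
  have upper: "eventually (\<lambda>t. (H' t)\<^sup>2 - H t * H'' t \<le> q\<^sub>2 * (H' t)\<^sup>2) at_top"
  proof (rule ccontr)
    assume neg: "\<not> ?thesis"
    have q2: "0 < q\<^sub>2" using q by linarith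
    have "eventually (\<lambda>t. q\<^sub>2 * (H' t)\<^sup>2 \<le> (H' t)\<^sup>2 - H t * H'' t) at_top"
      using compare[OF q(2) q2] neg by blast
    with base have "eventually (\<lambda>t. (H has_real_derivative H' t) (at t) \<and> (H' has_real_derivative H'' t) (at t) \<and>
       0 < H t \<and> 0 < H' t \<and> q\<^sub>2 * (H' t)\<^sup>2 \<le> (H' t)\<^sup>2 - H t * H'' t) at_top"
      by eventually_elim simp
    from growth_rate_le_of_ratio[OF q2 this] have "c \<le> 1 / q\<^sub>2" by (simp add: cH)
    then show False using q(5) c q2 by (simp add: field_simps)
  qed
  have lower: "eventually (\<lambda>t. q\<^sub>1 * (H' t)\<^sup>2 \<le> (H' t)\<^sup>2 - H t * H'' t) at_top"
  proof (rule ccontr)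
    assume neg: "\<not> ?thesis"
    have "eventually (\<lambda>t. (H' t)\<^sup>2 - H t * H'' t \<le> q\<^sub>1 * (H' t)\<^sup>2) at_top"
      using compare[OF q(1,3)] neg by blast
    with base have "eventually (\<lambda>t. (H has_real_derivative H' t) (at t) \<and> (H' has_real_derivative H'' t) (at t) \<and>
       0 < H t \<and> 0 < H' t \<and> (H' t)\<^sup>2 - H t * H'' t \<le> q\<^sub>1 * (H' t)\<^sup>2) at_top"
      by eventually_elim simp
    from growth_rate_ge_of_ratio[OF q(3) this] have "1 / q\<^sub>1 \<le> c" by (simp add: cH)
    then show False using q(3,4) c by (simp add: field_simps)
  qed
  show thesis
  proof (rule that[OF H])
    show "eventually (\<lambda>t. (H has_real_derivative H' t) (at t) \<and> (H' has_real_derivative H'' t) (at t) \<and>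
       0 < H t \<and> 0 < H' t \<and> (1 - q\<^sub>2) * (H' t)\<^sup>2 \<le> H t * H'' t \<and> H t * H'' t \<le> (1 - q\<^sub>1) * (H' t)\<^sup>2) at_top"
      using base upper lower by eventually_elim (auto simp: left_diff_distrib)
  qed
qed

section \<open>Inverses of regularly growing functions\<close>

text \<open>
  For the inverse \<open>\<phi>\<close> of \<open>H\<close> one has \<open>\<phi>' = 1 / H'\<close> and \<open>\<phi>'' = - H'' / H' ^ 3\<close> at \<open>\<phi> x\<close>. The upper bound for \<open>H H''\<close>
  makes \<open>H' * H powr (- \<beta>)\<close> nonincreasing, which bounds \<open>\<phi>'\<close> from below by a multiple of \<open>x powr (- \<beta>)\<close>; the lower
  bound gives \<open>- x \<phi>'' \<ge> \<kappa> \<phi>'\<close>.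
\<close>
lemma regular_inverse:
  fixes H H' H'' :: "real \<Rightarrow> real"
  assumes H: "\<And>t. T \<le> t \<Longrightarrow> (H has_real_derivative H' t) (at t)"
      "\<And>t. T \<le> t \<Longrightarrow> (H' has_real_derivative H'' t) (at t)" "\<And>t. T \<le> t \<Longrightarrow> 0 < H t" "\<And>t. T \<le> t \<Longrightarrow> 0 < H' t"
    and \<kappa>: "0 < \<kappa>" "\<And>t. T \<le> t \<Longrightarrow> \<kappa> * (H' t)\<^sup>2 \<le> H t * H'' t"
    and \<beta>: "\<And>t. T \<le> t \<Longrightarrow> H t * H'' t \<le> \<beta> * (H' t)\<^sup>2"
  obtains \<phi> p p' :: "real \<Rightarrow> real" and C where "0 < C"
    "\<And>x. H T \<le> x \<Longrightarrow> T \<le> \<phi> x \<and> H (\<phi> x) = x"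
    "\<And>x. H T < x \<Longrightarrow> (\<phi> has_real_derivative p x) (at x)"
    "\<And>x. H T < x \<Longrightarrow> (p has_real_derivative p' x) (at x)"
    "\<And>x. H T < x \<Longrightarrow> C * x powr (- \<beta>) \<le> p x"
    "\<And>x. H T < x \<Longrightarrow> p' x \<le> - (\<kappa> * C * x powr (- \<beta> - 1))"
proof -
  have strict: "H s < H t" if "T \<le> s" "s < t" for s t
    by (rule DERIV_pos_imp_increasing[OF that(2)]) (use H(1,4) that in \<open>meson order_trans\<close>)
  have H''pos: "0 < H'' t" if "T \<le> t" for t
  proof -
    have "0 < \<kappa> * (H' t)\<^sup>2" using \<kappa>(1) H(4)[OF that] by simp
    then have "0 < H t * H'' t" using \<kappa>(2)[OF that] by linarith
    then show ?thesis using H(3)[OF that] by (simp add: zero_less_mult_iff)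
  qed
  have H'mono: "H' T \<le> H' t" if "T \<le> t" for t
    by (rule DERIV_nonneg_imp_nondecreasing[OF that]) (use H(2) H''pos in \<open>meson less_imp_le\<close>)
  have H_linear: "H T + H' T * (t - T) \<le> H t" if "T \<le> t" for t
  proof -
    have "H T - H' T * T \<le> H t - H' T * t"
    proof (rule DERIV_nonneg_imp_nondecreasing[OF that])
      fix x assume "T \<le> x" "x \<le> t"
      then show "\<exists>y. ((\<lambda>t. H t - H' T * t) has_real_derivative y) (at x) \<and> 0 \<le> y"
        using H'mono by (intro exI[of _ "H' x - H' T * 1"] conjI DERIV_diff H(1) DERIV_cmult DERIV_ident) auto
    qed
    then show ?thesis by (simp add: algebra_simps)
  qed
  have contH: "isCont H t" if "T \<le> t" for t using H(1)[OF that] by (rule DERIV_isCont)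
  have surj: "\<exists>t\<ge>T. H t = x" if "H T \<le> x" for x
  proof -
    define b where "b = T + (x - H T) / H' T"
    have b: "T \<le> b" using that H(4)[of T] by (simp add: b_def)
    have "x \<le> H b" using H_linear[OF b] H(4)[of T] by (simp add: b_def)
    then have "\<exists>t\<ge>T. t \<le> b \<and> H t = x"
      using b that contH by (intro IVT) auto
    then show ?thesis by blast
  qed
  define \<phi> where "\<phi> = (\<lambda>x. SOME t. T \<le> t \<and> H t = x)"
  have \<phi>: "T \<le> \<phi> x \<and> H (\<phi> x) = x" if "H T \<le> x" for x
    unfolding \<phi>_def by (rule someI_ex) (use surj[OF that] in blast)
  have mono: "H T \<le> H t" if "T \<le> t" for t
    using strict[of T t] that by (cases "t = T") auto
  have \<phi>H: "\<phi> (H t) = t" if "T \<le> t" for t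
    using \<phi>[OF mono[OF that]] strict that by (metis linorder_neqE_linordered_idom order_less_irrefl)
  have \<phi>_gt: "T < \<phi> x" if "H T < x" for x
    using \<phi>[of x] that by (metis less_eq_real_def order_less_irrefl)
  define p where "p = (\<lambda>x. inverse (H' (\<phi> x)))"
  define p' where "p' = (\<lambda>x. - H'' (\<phi> x) * p x ^ 3)"
  have d\<phi>: "(\<phi> has_real_derivative p x) (at x)" if x: "H T < x" for x
  proof -
    have "isCont \<phi> (H (\<phi> x))"
    proof (rule isCont_inverse_function2[of T "\<phi> x" "\<phi> x + 1"])
      show "\<phi> (H z) = z" if "T \<le> z" for z using \<phi>H[OF that] .
      show "isCont H z" if "T \<le> z" for z using contH[OF that] .
    qed (use \<phi>_gt[OF x] in auto)
    then have cont: "isCont \<phi> x" using \<phi>[of x] x by simp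
    show ?thesis
      unfolding p_def
    proof (rule DERIV_inverse_function[where f = H and a = "H T" and b = "x + 1"])
      show "(H has_real_derivative H' (\<phi> x)) (at (\<phi> x))" using \<phi>[of x] x by (intro H(1)) auto
      show "H' (\<phi> x) \<noteq> 0" using \<phi>[of x] x H(4)[of "\<phi> x"] by auto
    qed (use x \<phi> cont in auto)
  qed
  have dp: "(p has_real_derivative p' x) (at x)" if x: "H T < x" for x
  proof -
    have T: "T \<le> \<phi> x" using \<phi>[of x] x by simp
    have "((\<lambda>x. H' (\<phi> x)) has_real_derivative H'' (\<phi> x) * p x) (at x)"
      by (rule DERIV_chain2[OF H(2)[OF T] d\<phi>[OF x]])
    then have "(p has_real_derivative - (inverse (H' (\<phi> x)) * (H'' (\<phi> x) * p x) * inverse (H' (\<phi> x)))) (at x)"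
      unfolding p_def using H(4)[OF T] by (intro DERIV_inverse') auto
    then show ?thesis by (simp add: p'_def p_def power3_eq_cube mult_ac)
  qed
  define C where "C = H T powr \<beta> / H' T"
  have C: "0 < C" using H(3,4)[of T] by (simp add: C_def)
  have H'_le: "H' t \<le> H t powr \<beta> / C" if "T \<le> t" for t
  proof -
    have "H' t * H t powr (- \<beta>) \<le> H' T * H T powr (- \<beta>)"
    proof (rule DERIV_nonpos_imp_nonincreasing[OF that])
      fix x assume x: "T \<le> x" "x \<le> t"
      have Hx: "0 < H x" using H(3) x by blast
      have "H x powr (- \<beta>) = H x powr (- \<beta> - 1 + 1)" by simp
      also have "\<dots> = H x * H x powr (- \<beta> - 1)" unfolding powr_add using Hx by simp
      finally have eq: "H x powr (- \<beta>) = H x * H x powr (- \<beta> - 1)" .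
      have "((\<lambda>t. H' t * H t powr (- \<beta>)) has_real_derivative
          H'' x * H x powr (- \<beta>) + ((- \<beta>) * H x powr (- \<beta> - 1) * H' x) * H' x) (at x)"
        using Hx x by (intro DERIV_mult H DERIV_fun_powr[OF H(1), THEN DERIV_cong]) (auto)
      moreover have "H'' x * H x powr (- \<beta>) + ((- \<beta>) * H x powr (- \<beta> - 1) * H' x) * H' x
          = (H x * H'' x - \<beta> * (H' x)\<^sup>2) * H x powr (- \<beta> - 1)"
        unfolding eq by (simp add: algebra_simps power2_eq_square)
      moreover have "\<dots> \<le> 0" using \<beta>[OF x(1)] by (intro mult_nonpos_nonneg) auto
      ultimately show "\<exists>y. ((\<lambda>t. H' t * H t powr (- \<beta>)) has_real_derivative y) (at x) \<and> y \<le> 0"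
        by metis
    qed
    then have "H' t / H t powr \<beta> \<le> 1 / C" by (simp add: powr_minus_divide C_def)
    then show ?thesis using H(3)[OF that] by (simp add: field_simps)
  qed
  have p_ge: "C * x powr (- \<beta>) \<le> p x" if x: "H T < x" for x
  proof -
    have T: "T \<le> \<phi> x" "H (\<phi> x) = x" using \<phi>[of x] x by simp_all
    have x0: "0 < x" using H(3)[of T] x by simp
    have "H' (\<phi> x) \<le> x powr \<beta> / C" using H'_le[OF T(1)] T(2) by simp
    then have "inverse (x powr \<beta> / C) \<le> p x"
      unfolding p_def using H(4)[OF T(1)] by (rule le_imp_inverse_le)
    then show ?thesis by (simp add: powr_minus divide_inverse mult_ac)
  qed
  have p'_le: "p' x \<le> - (\<kappa> * C * x powr (- \<beta> - 1))" if x: "H T < x" for x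
  proof -
    have T: "T \<le> \<phi> x" "H (\<phi> x) = x" using \<phi>[of x] x by simp_all
    have x0: "0 < x" using H(3)[of T] x by simp
    have pp: "0 < p x" using H(4)[OF T(1)] by (simp add: p_def)
    have "\<kappa> * (H' (\<phi> x))\<^sup>2 * p x ^ 3 \<le> (x * H'' (\<phi> x)) * p x ^ 3"
      using \<kappa>(2)[OF T(1)] T(2) pp by (intro mult_right_mono) auto
    moreover have "(H' (\<phi> x))\<^sup>2 * p x ^ 3 = p x"
    proof -
      have "H' (\<phi> x) * p x = 1" using H(4)[OF T(1)] by (simp add: p_def)
      moreover have "(H' (\<phi> x))\<^sup>2 * p x ^ 3 = (H' (\<phi> x) * p x)\<^sup>2 * p x"
        by (simp add: power2_eq_square power3_eq_cube)
      ultimately show ?thesis by simp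
    qed
    ultimately have "\<kappa> * p x \<le> x * (- p' x)" by (simp add: p'_def mult.assoc)
    then have "\<kappa> * (C * x powr (- \<beta>)) \<le> x * (- p' x)"
      using mult_left_mono[OF p_ge[OF x], of \<kappa>] \<kappa>(1) by linarith
    moreover have "x powr (- \<beta>) = x * x powr (- \<beta> - 1)"
      using powr_add[of x "- \<beta> - 1" 1] x0 by simp
    ultimately have "x * (\<kappa> * C * x powr (- \<beta> - 1)) \<le> x * (- p' x)" by (simp add: mult_ac)
    then have "\<kappa> * C * x powr (- \<beta> - 1) \<le> - p' x" using x0 by (simp only: mult_le_cancel_left_pos)
    then show ?thesis by linarith
  qed
  show thesis using that[OF C \<phi> d\<phi> dp p_ge p'_le] by blast
qed

lemma finite_differences_of_concave:
  fixes \<phi> p p' :: "real \<Rightarrow> real"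
  assumes d: "\<And>x. x\<^sub>0 < x \<Longrightarrow> (\<phi> has_real_derivative p x) (at x)" "\<And>x. x\<^sub>0 < x \<Longrightarrow> (p has_real_derivative p' x) (at x)"
    and y: "x\<^sub>0 < y"
    and \<Lambda>: "\<And>x. y \<le> x \<Longrightarrow> x \<le> y + 2 \<Longrightarrow> p' x \<le> - \<Lambda>"
  shows "\<Lambda> \<le> (\<phi> (y + 1) - \<phi> y) - (\<phi> (y + 2) - \<phi> (y + 1))"
proof -
  have "\<exists>z. y < z \<and> z < y + 1 \<and> (\<phi> (y + 1 + 1) - \<phi> (y + 1)) - (\<phi> (y + 1) - \<phi> y) = (y + 1 - y) * (p (z + 1) - p z)"
    by (rule MVT2[of y "y + 1" "\<lambda>x. \<phi> (x + 1) - \<phi> x" "\<lambda>x. p (x + 1) - p x"])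
       (use y in \<open>auto intro!: DERIV_diff d(1) DERIV_shift[THEN iffD1]\<close>)
  then obtain z where z: "y < z" "z < y + 1" "(\<phi> (y + 2) - \<phi> (y + 1)) - (\<phi> (y + 1) - \<phi> y) = p (z + 1) - p z"
    by (auto simp: add.assoc)
  have "\<exists>w. z < w \<and> w < z + 1 \<and> p (z + 1) - p z = (z + 1 - z) * p' w"
    by (rule MVT2) (use y z d(2) in auto)
  then obtain w where "z < w" "w < z + 1" "p (z + 1) - p z = p' w" by auto
  moreover from this z have "p' w \<le> - \<Lambda>" by (intro \<Lambda>) auto
  ultimately show ?thesis using z(3) by linarith
qed

lemma finite_difference_ge:
  fixes \<phi> p :: "real \<Rightarrow> real"
  assumes d: "\<And>x. x\<^sub>0 < x \<Longrightarrow> (\<phi> has_real_derivative p x) (at x)" and y: "x\<^sub>0 < y"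
    and \<delta>: "\<And>x. y \<le> x \<Longrightarrow> x \<le> y + 1 \<Longrightarrow> \<delta> \<le> p x"
  shows "\<delta> \<le> \<phi> (y + 1) - \<phi> y"
proof -
  have "\<exists>z. y < z \<and> z < y + 1 \<and> \<phi> (y + 1) - \<phi> y = (y + 1 - y) * p z"
    by (rule MVT2) (use y d in auto)
  then obtain z where "y < z" "z < y + 1" "\<phi> (y + 1) - \<phi> y = p z" by auto
  with \<delta>[of z] show ?thesis by auto
qed

section \<open>Bounds for Hardy field functions\<close>

lemma floor_values_memberI:
  assumes "u < ereal (real n)" "1 \<le> n" "s \<in> {1, - 1}"
  shows "s * \<lfloor>h (real n)\<rfloor> \<in> floor_values u h"
  using assms unfolding floor_values_def by blast

text \<open>
  Take \<open>\<delta>\<close> of order \<open>N powr (- \<beta>)\<close> and \<open>\<Lambda>\<close> of order \<open>N powr (- \<beta> - 1)\<close>, the lower bounds for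
  \<open>\<phi>'\<close> and \<open>- \<phi>''\<close> at \<open>N\<close>; then \<open>1 / (\<delta>\<^sup>2 sqrt \<Lambda> N)\<close> is of order \<open>N powr (5 / 2 * \<beta> - 1 / 2)\<close>.
\<close>
theorem cos_gamma_floor_values_bound:
  fixes h :: "real \<Rightarrow> real" and u :: ereal and c :: real
  assumes h: "hardy_field_function u h" and c: "growth_rate h = ereal c" "1 < c"
    and \<beta>: "1 - 1 / c < \<beta>" "\<beta> < 1"
  shows "\<exists>C. \<forall>N\<ge>1. cos_gamma (floor_values u h) N
      \<le> C * (1 / real N + real N powr (5 / 2 * \<beta> - 1 / 2))"
proof -
  obtain q\<^sub>1 where q1: "q\<^sub>1 \<in> \<rat>" "1 - \<beta> < q\<^sub>1" "q\<^sub>1 < 1 / c" using Rats_dense_in_real[of "1 - \<beta>" "1 / c"] \<beta> by auto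
  have "1 / c < 1" using c by simp
  then obtain q\<^sub>2 where q2: "q\<^sub>2 \<in> \<rat>" "1 / c < q\<^sub>2" "q\<^sub>2 < 1" using Rats_dense_in_real by blast
  define \<kappa> where "\<kappa> = 1 - q\<^sub>2"
  have \<kappa>: "0 < \<kappa>" using q2 by (simp add: \<kappa>_def)
  obtain K where K: "hardy_field K" "germ h \<in> K" using h unfolding hardy_field_function_def by blast
  have u: "u \<noteq> \<infinity>" "smooth_on {t. u < ereal t} h" using h unfolding hardy_field_function_def by auto
  obtain u' where u': "\<And>t. u' < t \<Longrightarrow> u < ereal t"
  proof (cases u)
    case (real r)
    then show ?thesis using that[of r] by simp
  qed (use u that in auto)
  have "smooth_on {u'<..} h" using u(2) u' unfolding smooth_on_def by auto
  then have hK: "in_germ_field K h" using K(2) by (auto simp: in_germ_field_def ev_smooth_def)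
  obtain H H' H'' where H: "H = h \<or> H = (\<lambda>t. - h t)" and
    ev: "eventually (\<lambda>t. (H has_real_derivative H' t) (at t) \<and> (H' has_real_derivative H'' t) (at t) \<and>
       0 < H t \<and> 0 < H' t \<and> (1 - q\<^sub>2) * (H' t)\<^sup>2 \<le> H t * H'' t \<and> H t * H'' t \<le> (1 - q\<^sub>1) * (H' t)\<^sup>2) at_top"
  proof (rule hardy_field_regular_growth[OF K(1) hK c(1) _ q1(1) q2(1) _ q1(3) q2(2)])
    show "0 < q\<^sub>1" using q1 \<beta> by linarith
  qed (use c in auto)
  have "eventually (\<lambda>t. u < ereal t \<and> 1 \<le> t) at_top"
    using eventually_gt_at_top[of u'] eventually_ge_at_top[of 1] by eventually_elim (auto intro: u')
  with ev have "eventually (\<lambda>t. (H has_real_derivative H' t) (at t) \<and> (H' has_real_derivative H'' t) (at t) \<and>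
       0 < H t \<and> 0 < H' t \<and> \<kappa> * (H' t)\<^sup>2 \<le> H t * H'' t \<and> H t * H'' t \<le> \<beta> * (H' t)\<^sup>2 \<and> u < ereal t \<and> 1 \<le> t) at_top"
  proof eventually_elim
    case (elim t)
    have "(1 - q\<^sub>1) * (H' t)\<^sup>2 \<le> \<beta> * (H' t)\<^sup>2" using q1 by (intro mult_right_mono) auto
    then show ?case using elim unfolding \<kappa>_def by linarith
  qed
  then obtain T where T: "\<And>t. T \<le> t \<Longrightarrow> (H has_real_derivative H' t) (at t)"
      "\<And>t. T \<le> t \<Longrightarrow> (H' has_real_derivative H'' t) (at t)" "\<And>t. T \<le> t \<Longrightarrow> 0 < H t" "\<And>t. T \<le> t \<Longrightarrow> 0 < H' t"
      "\<And>t. T \<le> t \<Longrightarrow> \<kappa> * (H' t)\<^sup>2 \<le> H t * H'' t" "\<And>t. T \<le> t \<Longrightarrow> H t * H'' t \<le> \<beta> * (H' t)\<^sup>2"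
      "\<And>t. T \<le> t \<Longrightarrow> u < ereal t \<and> 1 \<le> t"
    by (auto simp: eventually_at_top_linorder)
  obtain \<phi> p p' C where C: "0 < C"
    and \<phi>: "\<And>x. H T \<le> x \<Longrightarrow> T \<le> \<phi> x \<and> H (\<phi> x) = x"
    and d: "\<And>x. H T < x \<Longrightarrow> (\<phi> has_real_derivative p x) (at x)"
      "\<And>x. H T < x \<Longrightarrow> (p has_real_derivative p' x) (at x)"
    and p: "\<And>x. H T < x \<Longrightarrow> C * x powr (- \<beta>) \<le> p x"
      "\<And>x. H T < x \<Longrightarrow> p' x \<le> - (\<kappa> * C * x powr (- \<beta> - 1))"
    by (rule regular_inverse[OF T(1-4) \<kappa> T(5,6)]) (assumption | rule that)+
  have H_strict: "H s < H t" if "T \<le> s" "s < t" for s t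
    by (rule DERIV_pos_imp_increasing[OF that(2)]) (use T(1,4) that in \<open>meson order_trans\<close>)
  have \<beta>0: "0 < \<beta>" using \<beta> \<open>1 / c < 1\<close> by linarith
  \<comment> \<open>\<open>m = \<lfloor>H n\<rfloor>\<close> if \<open>H n\<close> lies in \<open>(m, m + 1)\<close>; for negative \<open>h\<close>, \<open>m = - \<lfloor>h n\<rfloor>\<close> if \<open>H n\<close> lies in \<open>(m - 1, m)\<close>.\<close>
  define \<tau> :: real where "\<tau> = (if H = h then 0 else 1)"
  define P where "P = (\<lambda>m::nat. \<phi> (real m - \<tau>))"
  define m\<^sub>0 where "m\<^sub>0 = nat \<lceil>H T\<rceil> + 2"
  have m0: "1 \<le> m\<^sub>0" "H T < real m\<^sub>0 - \<tau>" "0 < real m\<^sub>0 - \<tau>" using T(3)[of T] by (auto simp: m\<^sub>0_def \<tau>_def) linarith+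
  define V where "V = \<bar>P (Suc m\<^sub>0) - P m\<^sub>0\<bar>"
  have member: "int m \<in> floor_values u h" if "m\<^sub>0 \<le> m" "P m < of_int n" "of_int n < P (Suc m)" for m n
  proof -
    define y where "y = real m - \<tau>"
    have y: "H T \<le> y" "H T \<le> y + 1" using m0 that(1) by (auto simp: y_def)
    have n: "\<phi> y < of_int n" "of_int n < \<phi> (y + 1)" using that by (simp_all add: P_def y_def algebra_simps)
    have Tn: "T \<le> of_int n" using \<phi>[OF y(1)] n by linarith
    have b: "y < H (of_int n)" "H (of_int n) < y + 1"
      using H_strict[of "\<phi> y" "of_int n"] H_strict[OF Tn n(2)] \<phi>[OF y(1)] \<phi>[OF y(2)] n by auto
    define k where "k = nat n"
    have k: "real k = of_int n" "1 \<le> k" "u < ereal (real k)" using T(7)[OF Tn] by (auto simp: k_def)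
    show ?thesis
    proof (cases "H = h")
      case True
      have "\<lfloor>h (real k)\<rfloor> = int m" using b True k by (intro floor_unique) (auto simp: y_def \<tau>_def)
      then show ?thesis using floor_values_memberI[OF k(3,2), of 1 h] by simp
    next
      case False
      then have "H = (\<lambda>t. - h t)" using H by blast
      then have "\<lfloor>h (real k)\<rfloor> = - int m" using b False k by (intro floor_unique) (auto simp: y_def \<tau>_def)
      then show ?thesis using floor_values_memberI[OF k(3,2), of "- 1" h] by simp
    qed
  qed
  \<comment> \<open>The finite differences reach up to \<open>N + 1 \<le> 3 N\<close>, where the powers are smaller than at \<open>N\<close> by a factor less
      than \<open>4\<close> for \<open>\<phi>'\<close> and at most \<open>9\<close> for \<open>\<phi>''\<close>. The cap \<open>1\<close> in \<open>l\<close> ensures \<open>\<Lambda> N \<le> 1\<close>.\<close>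
  define \<delta> where "\<delta> = (\<lambda>N. C / 16 * real N powr (- \<beta>))"
  define l where "l = min 1 (\<kappa> * C / 9)"
  define \<Lambda> where "\<Lambda> = (\<lambda>N. l * real N powr (- \<beta> - 1))"
  have l: "0 < l" "l \<le> 1" "9 * l \<le> \<kappa> * C" using \<kappa> C by (auto simp: l_def)
  have bound: "cos_gamma (floor_values u h) N
     \<le> 2 * (real m\<^sub>0 + 1) / real N + 8 * (V + 2) * zeta_three_halves / ((\<delta> N)\<^sup>2 * sqrt (\<Lambda> N) * real N)" if N: "1 \<le> N" for N
  proof (rule cos_gamma_le_of_concave_inverse[OF N m0(1)])
    show "0 < \<delta> N" "0 < \<Lambda> N" using N C l by (auto simp: \<delta>_def \<Lambda>_def)
    have "\<Lambda> N * real N = l * real N powr (- \<beta>)"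
      using N powr_add[of "real N" "- \<beta> - 1" 1] by (simp add: \<Lambda>_def)
    also have "\<dots> \<le> 1 * real N powr 0"
      using N l \<beta>0 by (intro mult_mono powr_mono) auto
    finally show "\<Lambda> N * real N \<le> 1" using N by simp
    have scale: "real N powr (- e) \<le> 3 powr e * x powr (- e)" if "0 < e" "0 < x" "x \<le> 3 * real N" for e x
    proof -
      have "(3 * real N) powr (- e) \<le> x powr (- e)" using that by (intro powr_mono2') auto
      then have "3 powr e * (3 powr (- e) * real N powr (- e)) \<le> 3 powr e * x powr (- e)"
        using N by (intro mult_left_mono) (auto simp: powr_mult)
      then show ?thesis by (simp add: mult.assoc[symmetric] powr_add[symmetric])
    qed
    show "\<Lambda> N \<le> P (Suc m) - P m - (P (Suc (Suc m)) - P (Suc m))" if m: "m\<^sub>0 \<le> m" "m < N" for m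
    proof -
      define y where "y = real m - \<tau>"
      have y: "H T < y" "0 < y" "y + 2 \<le> 3 * real N" using m0 m by (auto simp: y_def \<tau>_def)
      have "\<Lambda> N \<le> (\<phi> (y + 1) - \<phi> y) - (\<phi> (y + 2) - \<phi> (y + 1))"
      proof (rule finite_differences_of_concave[OF d y(1)])
        fix x assume x: "y \<le> x" "x \<le> y + 2"
        have "real N powr (- (\<beta> + 1)) \<le> 3 powr (\<beta> + 1) * x powr (- (\<beta> + 1))"
          using \<beta>0 x y by (intro scale) auto
        also have "\<dots> \<le> 3 powr 2 * x powr (- (\<beta> + 1))"
          using \<beta> by (intro mult_right_mono powr_mono) auto
        finally have "\<Lambda> N \<le> l * (9 * x powr (- (\<beta> + 1)))"
          unfolding \<Lambda>_def using l by (intro mult_left_mono) auto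
        also have "\<dots> = (9 * l) * x powr (- \<beta> - 1)" by simp
        also have "\<dots> \<le> \<kappa> * C * x powr (- \<beta> - 1)" using l by (intro mult_right_mono) auto
        finally show "p' x \<le> - \<Lambda> N" using p(2)[of x] x y by linarith
      qed
      then show ?thesis by (simp add: P_def y_def algebra_simps)
    qed
    show "4 * \<delta> N \<le> P (Suc m) - P m" if m: "m\<^sub>0 \<le> m" "m \<le> N" for m
    proof -
      define y where "y = real m - \<tau>"
      have y: "H T < y" "0 < y" "y + 1 \<le> 3 * real N" using m0 m N by (auto simp: y_def \<tau>_def)
      have "4 * \<delta> N \<le> \<phi> (y + 1) - \<phi> y"
      proof (rule finite_difference_ge[OF d(1) y(1)])
        fix x assume x: "y \<le> x" "x \<le> y + 1"
        have "real N powr (- \<beta>) \<le> 3 powr \<beta> * x powr (- \<beta>)"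
          using \<beta>0 x y by (intro scale) auto
        also have "\<dots> \<le> 3 powr 1 * x powr (- \<beta>)"
          using \<beta> by (intro mult_right_mono powr_mono) auto
        finally have "C / 4 * real N powr (- \<beta>) \<le> C / 4 * (4 * x powr (- \<beta>))"
          using C by (intro mult_left_mono) (auto intro: order_trans)
        then show "4 * \<delta> N \<le> p x" using p(1)[of x] x y by (simp add: \<delta>_def)
      qed
      then show ?thesis by (simp add: P_def y_def algebra_simps)
    qed
  qed (use member in \<open>auto simp: V_def\<close>)
  define C' where "C' = 2 * (real m\<^sub>0 + 1) + 8 * (V + 2) * zeta_three_halves / ((C / 16)\<^sup>2 * sqrt l)"
  have C'2: "0 \<le> 8 * (V + 2) * zeta_three_halves / ((C / 16)\<^sup>2 * sqrt l)"
    using zeta_three_halves_nonneg l by (simp add: V_def)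
  have "cos_gamma (floor_values u h) N \<le> C' * (1 / real N + real N powr (5 / 2 * \<beta> - 1 / 2))" if N: "1 \<le> N" for N
  proof -
    have N0: "0 < real N" using N by simp
    have "(\<delta> N)\<^sup>2 = (C / 16)\<^sup>2 * real N powr (- 2 * \<beta>)"
      using N0 by (simp add: \<delta>_def power_mult_distrib power2_eq_square powr_add[symmetric])
    moreover have "sqrt (\<Lambda> N) = sqrt l * real N powr ((- \<beta> - 1) / 2)"
      using N0 by (simp add: \<Lambda>_def real_sqrt_mult powr_half_sqrt[symmetric] powr_powr)
    moreover have "real N powr (- 2 * \<beta>) * real N powr ((- \<beta> - 1) / 2) * real N = real N powr (- (5 / 2 * \<beta> - 1 / 2))"
    proof -
      have "real N powr (- 2 * \<beta>) * real N powr ((- \<beta> - 1) / 2) * real N powr 1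
        = real N powr (- 2 * \<beta> + (- \<beta> - 1) / 2 + 1)" by (simp only: powr_add)
      moreover have "- 2 * \<beta> + (- \<beta> - 1) / 2 + 1 = - (5 / 2 * \<beta> - 1 / 2)" by (simp add: field_simps)
      ultimately show ?thesis using N0 by simp
    qed
    ultimately have "(\<delta> N)\<^sup>2 * sqrt (\<Lambda> N) * real N = ((C / 16)\<^sup>2 * sqrt l) * real N powr (- (5 / 2 * \<beta> - 1 / 2))"
      by (simp add: mult_ac)
    then have "8 * (V + 2) * zeta_three_halves / ((\<delta> N)\<^sup>2 * sqrt (\<Lambda> N) * real N)
        = 8 * (V + 2) * zeta_three_halves / ((C / 16)\<^sup>2 * sqrt l) * real N powr (5 / 2 * \<beta> - 1 / 2)"
      by (simp add: powr_minus_divide powr_diff)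
    also have "\<dots> \<le> C' * real N powr (5 / 2 * \<beta> - 1 / 2)"
      by (intro mult_right_mono) (auto simp: C'_def)
    finally have "8 * (V + 2) * zeta_three_halves / ((\<delta> N)\<^sup>2 * sqrt (\<Lambda> N) * real N) \<le> C' * real N powr (5 / 2 * \<beta> - 1 / 2)" .
    moreover have "2 * (real m\<^sub>0 + 1) / real N \<le> C' * (1 / real N)"
      using C'2 N0 by (simp add: C'_def divide_right_mono)
    ultimately show ?thesis using bound[OF N] by (simp only: distrib_left)
  qed
  then show ?thesis by blast
qed

theorem theorem1p4:
  fixes h :: "real \<Rightarrow> real" and u :: ereal and c :: real
  assumes "hardy_field_function u h"
    and "growth_rate h = ereal c"
    and "1 < c" and "c < 6 / 5"
  shows "(\<forall>\<epsilon>::real. \<epsilon> > 0 \<longrightarrow> (\<exists>C::real. C > 0 \<and> (\<forall>N::nat. N \<ge> 1 \<longrightarrow>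
            \<bar>cos_gamma (floor_values u h) N\<bar> \<le> C * real N powr (- (6 / (5 * c) - 1) + \<epsilon>))))
       \<and> (\<forall>\<epsilon>::real. \<epsilon> > 0 \<longrightarrow> (\<exists>C::real. C > 0 \<and> (\<forall>N::nat. N \<ge> 1 \<longrightarrow> (\<forall>A::int set.
            A \<subseteq> {1..int N} \<longrightarrow>
            \<not> (\<exists>x::int. \<exists>n::nat. \<exists>s::int. n \<ge> 1 \<and> u < ereal (real n) \<and> h (real n) \<noteq> 0 \<and>
                 s \<in> {1, -1} \<and> x \<in> A \<and> x + s * \<lfloor>h (real n)\<rfloor> \<in> A) \<longrightarrow>
            real (card A) \<le> C * real N powr (1 - (6 / (5 * c) - 1) + \<epsilon>)))))"
proof -
  define S where "S = floor_values u h"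
  define e where "e = - (6 / (5 * c) - 1)"
  \<comment> \<open>With \<open>\<beta> = 1 - 1 / c + \<eta>\<close>, the inequality \<open>5 / 2 * \<beta> - 1 / 2 \<le> 1 - 6 / 5 * (1 / c)\<close> holds for all \<open>1 / c > 5 / 6\<close>
      exactly when \<open>\<eta> \<le> 1 / 30\<close>.\<close>
  define \<beta> where "\<beta> = 31 / 30 - 1 / c"
  have c1: "5 / 6 < 1 / c" "1 / c < 1" using assms(3,4) by (simp_all add: field_simps)
  have e: "e = 1 - 6 / 5 * (1 / c)" by (simp add: e_def)
  have \<beta>: "1 - 1 / c < \<beta>" "\<beta> < 1" "5 / 2 * \<beta> - 1 / 2 \<le> e" "- 1 \<le> e"
  proof -
    define r where "r = 1 / c"
    have "5 / 6 < r" "r < 1" using c1 by (simp_all add: r_def)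
    then show "1 - 1 / c < \<beta>" "\<beta> < 1" "5 / 2 * \<beta> - 1 / 2 \<le> e" "- 1 \<le> e"
      unfolding \<beta>_def e r_def[symmetric] by (simp_all add: field_simps)
  qed
  obtain C where C: "\<And>N. 1 \<le> N \<Longrightarrow> cos_gamma S N \<le> C * (1 / real N + real N powr (5 / 2 * \<beta> - 1 / 2))"
    using cos_gamma_floor_values_bound[OF assms(1-3) \<beta>(1,2)] unfolding S_def by blast
  define D where "D = 2 * \<bar>C\<bar> + 1"
  have D: "0 < D" by (simp add: D_def)
  have gamma: "cos_gamma S N \<le> D * real N powr (e + \<epsilon>)" if "1 \<le> N" "0 < \<epsilon>" for N \<epsilon>
  proof -
    have "1 / real N = real N powr (- 1)" using that by (simp add: powr_minus_divide)
    also have "\<dots> \<le> real N powr (e + \<epsilon>)" using that \<beta> by (intro powr_mono) auto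
    finally have 1: "1 / real N \<le> real N powr (e + \<epsilon>)" .
    have 2: "real N powr (5 / 2 * \<beta> - 1 / 2) \<le> real N powr (e + \<epsilon>)"
      using that \<beta> by (intro powr_mono) auto
    have "cos_gamma S N \<le> \<bar>C\<bar> * (1 / real N + real N powr (5 / 2 * \<beta> - 1 / 2))"
      by (rule order_trans[OF C[OF that(1)]]) (auto intro!: mult_right_mono)
    also have "\<dots> \<le> \<bar>C\<bar> * (2 * real N powr (e + \<epsilon>))"
      using 1 2 by (intro mult_left_mono) auto
    also have "\<dots> \<le> D * real N powr (e + \<epsilon>)" by (simp add: D_def distrib_right)
    finally show ?thesis .
  qed
  have set_bound: "real (card A) \<le> (2 * D) * real N powr (1 + e + \<epsilon>)"
    if N: "1 \<le> N" and \<epsilon>: "0 < \<epsilon>" and A: "A \<subseteq> {1..int N}"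
      and free: "\<not> (\<exists>x::int. \<exists>n::nat. \<exists>s::int. n \<ge> 1 \<and> u < ereal (real n) \<and> h (real n) \<noteq> 0 \<and>
                 s \<in> {1, -1} \<and> x \<in> A \<and> x + s * \<lfloor>h (real n)\<rfloor> \<in> A)" for N A \<epsilon>
  proof -
    have "real (card A) \<le> 2 * real N * cos_gamma S N"
    proof (rule card_difference_free_le_cos_gamma[OF A N])
      fix x y assume xy: "x \<in> A" "y \<in> A"
      show "y - x \<notin> S \<inter> {1..int N}"
      proof
        assume "y - x \<in> S \<inter> {1..int N}"
        then obtain s n where sn: "y - x = s * \<lfloor>h (real n)\<rfloor>" "s \<in> {1, - 1}" "1 \<le> n" "u < ereal (real n)"
          and pos: "1 \<le> y - x" unfolding S_def floor_values_def by auto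
        have "h (real n) \<noteq> 0" using sn(1) pos by auto
        moreover have "x + s * \<lfloor>h (real n)\<rfloor> \<in> A" using sn(1) xy by (simp flip: sn(1))
        ultimately show False using free sn xy by blast
      qed
    qed
    also have "\<dots> \<le> 2 * real N * (D * real N powr (e + \<epsilon>))"
      by (intro mult_left_mono gamma N \<epsilon>) simp
    also have "\<dots> = (2 * D) * (real N powr 1 * real N powr (e + \<epsilon>))" using N by simp
    also have "real N powr 1 * real N powr (e + \<epsilon>) = real N powr (1 + e + \<epsilon>)"
      by (simp only: powr_add[symmetric] add.assoc)
    finally show ?thesis .
  qed
  show ?thesis
  proof (intro conjI allI impI)
    fix \<epsilon> :: real assume \<epsilon>: "\<epsilon> > 0"
    have exponent: "- (6 / (5 * c) - 1) + \<epsilon> = e + \<epsilon>" "1 - (6 / (5 * c) - 1) + \<epsilon> = 1 + e + \<epsilon>"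
      by (simp_all add: e_def)
    show "\<exists>C>0. \<forall>N\<ge>1. \<bar>cos_gamma (floor_values u h) N\<bar> \<le> C * real N powr (- (6 / (5 * c) - 1) + \<epsilon>)"
      unfolding exponent
    proof (intro exI[of _ D] conjI allI impI D)
      fix N :: nat assume "N \<ge> 1"
      then show "\<bar>cos_gamma (floor_values u h) N\<bar> \<le> D * real N powr (e + \<epsilon>)"
        using gamma[of N \<epsilon>] cos_gamma_nonneg[of N S] \<epsilon> by (simp add: S_def)
    qed
    show "\<exists>C>0. \<forall>N\<ge>1. \<forall>A. A \<subseteq> {1..int N} \<longrightarrow>
            \<not> (\<exists>x::int. \<exists>n::nat. \<exists>s::int. n \<ge> 1 \<and> u < ereal (real n) \<and> h (real n) \<noteq> 0 \<and>
                 s \<in> {1, -1} \<and> x \<in> A \<and> x + s * \<lfloor>h (real n)\<rfloor> \<in> A) \<longrightarrow>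
            real (card A) \<le> C * real N powr (1 - (6 / (5 * c) - 1) + \<epsilon>)"
      unfolding exponent
    proof (intro exI[of _ "2 * D"] conjI allI impI)
      show "0 < 2 * D" using D by simp
    qed (rule set_bound[OF _ \<epsilon>])
  qed
qed

end
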